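(* The Mathieu group $M_{24}$ is generated by symbols $\mathfrak{s},\mathfrak{j},\mathfrak{t},\mathfrak{r},\mathfrak{u},\mathfrak{v},\mathfrak{w}$, subject to the defining relations $$\mathfrak{s}^2=\mathfrak{j}^2=\mathfrak{t}^2=\mathfrak{r}^3=(\mathfrak{j}\mathfrak{r})^2=(\mathfrak{t}\mathfrak{r})^2=(\mathfrak{s}\mathfrak{r})^3=(\mathfrak{j}\mathfrak{s})^3=(\mathfrak{t}\mathfrak{j})^3=(\mathfrak{t}\mathfrak{s}\mathfrak{t}\mathfrak{j}\mathfrak{s})^3=1,$$ $$\mathfrak{t}\mathfrak{s}\mathfrak{t}\cdot\mathfrak{j}\mathfrak{r}\cdot\mathfrak{t}\mathfrak{s}\mathfrak{t}=\mathfrak{r}\mathfrak{s}\mathfrak{r}^{-1}\mathfrak{j}\mathfrak{r}\cdot\mathfrak{t}\mathfrak{s}\mathfrak{t}\cdot\mathfrak{r}\mathfrak{s}\mathfrak{r}^{-1}\mathfrak{j}\mathfrak{r}^{-1}\mathfrak{s}\mathfrak{r}^{-1},$$ $$\mathfrak{u}^2=(\mathfrak{u}\mathfrak{s})^2=(\mathfrak{u}\mathfrak{j})^3=1,\quad \mathfrak{r}^{\mathfrak{u}}=\mathfrak{r}^{\mathfrak{j}},\quad \mathfrak{s}^{\mathfrak{t}\mathfrak{u}}=\mathfrak{s}\,\mathfrak{s}^{\mathfrak{t}},\quad \mathfrak{s}^{\mathfrak{j}\mathfrak{t}\mathfrak{u}}=\mathfrak{s}^{\mathfrak{j}\mathfrak{t}}\,\mathfrak{s}^{\mathfrak{t}\mathfrak{j}\mathfrak{t}},$$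 $$\mathfrak{v}^2=(\mathfrak{v}\mathfrak{s})^2=(\mathfrak{v}\mathfrak{u})^3=(\mathfrak{v}\mathfrak{j})^2=(\mathfrak{v}\mathfrak{r})^2=1,\quad \mathfrak{s}^{\mathfrak{t}\mathfrak{v}}=\mathfrak{s}^{\mathfrak{t}\mathfrak{r}},\quad \mathfrak{s}^{\mathfrak{j}\mathfrak{t}\mathfrak{v}}=\mathfrak{s}^{\mathfrak{j}\mathfrak{t}\mathfrak{r}},$$ $$\mathfrak{w}^2=(\mathfrak{w}\mathfrak{r})^2=(\mathfrak{w}\mathfrak{s})^2=(\mathfrak{w}\mathfrak{j})^2=(\mathfrak{w}\mathfrak{u})^2=(\mathfrak{w}\mathfrak{s}^{\mathfrak{t}})^2=(\mathfrak{w}\mathfrak{s}^{\mathfrak{j}\mathfrak{t}})^2=(\mathfrak{w}\mathfrak{v})^3=1.$$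
   Context: Conventions: $x^y=y^{-1}xy$; permutations are composed from right to left. The statement means that the abstract group with this presentation is isomorphic to $M_{24}$, with the symbols corresponding to the following permutations. Let $\zeta$ be a primitive element of $GF(4)$ and $\Omega=\mathbb{P}^2(4)$ the set of 21 points $[x,y,z]$ of the projective plane over $GF(4)$, on which matrices act by left multiplication on column vectors $(x,y,z)^t$. Let $u,v,w\notin\Omega$ be three distinct new points and $\Omega'''=\Omega\cup\{u,v,w\}$. The symbols $\mathfrak{s},\mathfrak{j},\mathfrak{t},\mathfrak{r}$ correspond to the elements of $PSL_3(4)$ (acting on $\Omega$, fixing $u,v,w$) induced by the matrices $\begin{pmatrix}1&1&0\\0&1&0\\0&0&1\end{pmatrix}$, $\begin{pmatrix}0&1&0\\1&0&0\\0&0&1\end{pmatrix}$, $\begin{pmatrix}0&0&1\\0&1&0\\1&0&0\end{pmatrix}$, $\begin{pmatrix}\zeta&0&0\\0&1&0\\0&0&\zeta^{-1}\end{pmatrix}$, respectively; $\mathfrak{u}$ corresponds to the permutation fixing $v,w$ with $u\mapsto[1,0,0]$, $[1,0,0]\mapsto u$, and $[x,y,z]\mapsto[x^2+yz,y^2,z^2]$ for $[x,y,z]\in\Omega\setminus\{[1,0,0]\}$; $\mathfrak{v}$ to the permutation interchanging $u$ and $v$, fixing $w$, with $[x,y,z]\mapsto[x^2,y^2,\zeta z^2]$ on $\Omega$; and $\mathfrak{w}$ to the permutation fixing $u$, interchanging $v$ and $w$, with $[x,y,z]\mapsto[x^2,y^2,z^2]$ on $\Omega$. $M_{24}$ is the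 ($5$-transitive) permutation group on $\Omega'''$ generated by $PSL_3(4)$, $\mathfrak{u}$, $\mathfrak{v}$ and $\mathfrak{w}$. *)

theory Defs
  imports "HOL-Analysis.Analysis" "HOL-Algebra.Bij" "HOL-Algebra.Generated_Groups"
begin

section \<open>Group presentations\<close>

datatype 'g letter = Pos 'g | Neg 'g

type_synonym 'g word = "'g letter list"

fun letter_inv :: "'g letter \<Rightarrow> 'g letter" where
  "letter_inv (Pos x) = Neg x"
| "letter_inv (Neg x) = Pos x"

definition winv :: "'g word \<Rightarrow> 'g word" where
  "winv w = rev (map letter_inv w)"

definition wpow :: "'g word \<Rightarrow> nat \<Rightarrow> 'g word" where
  "wpow w n = concat (replicate n w)"

text \<open>The convention is \<open>x^y = y^{-1} x y\<close>.\<close>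

definition wconj :: "'g word \<Rightarrow> 'g word \<Rightarrow> 'g word" where
  "wconj x y = winv y @ x @ y"

text \<open>A pair \<open>(l, r)\<close> in \<open>R\<close> stands for the defining relation \<open>l = r\<close>. The group
  presented by \<open>R\<close>, with all elements of the type \<open>'g\<close> as generators, consists of the words
  modulo the least congruence that contains the free cancellations and \<open>R\<close>; equivalently, it is
  the free group on \<open>'g\<close> modulo the normal closure of the relators \<open>l r^{-1}\<close>.\<close>

inductive pres_eq :: "('g word \<times> 'g word) set \<Rightarrow> 'g word \<Rightarrow> 'g word \<Rightarrow> bool"
  for R where
  refl: "pres_eq R a a"
| sym: "pres_eq R a b \<Longrightarrow> pres_eq R b a"
| trans: "pres_eq R a b \<Longrightarrow> pres_eq R b c \<Longrightarrow> pres_eq R a c"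
| append: "pres_eq R a b \<Longrightarrow> pres_eq R c d \<Longrightarrow> pres_eq R (a @ c) (b @ d)"
| cancel: "pres_eq R [x, letter_inv x] []"
| rel: "(l, r) \<in> R \<Longrightarrow> pres_eq R l r"

definition pres_class :: "('g word \<times> 'g word) set \<Rightarrow> 'g word \<Rightarrow> 'g word set" where
  "pres_class R a = {b. pres_eq R a b}"

definition presented_group :: "('g word \<times> 'g word) set \<Rightarrow> 'g word set monoid" where
  "presented_group R =
    \<lparr>carrier = range (pres_class R),
     mult = (\<lambda>A B. \<Union>a\<in>A. \<Union>b\<in>B. pres_class R (a @ b)),
     one = pres_class R []\<rparr>"

lemma pres_class_eq_iff: "pres_class R a = pres_class R b \<longleftrightarrow> pres_eq R a b"
proof
  assume "pres_class R a = pres_class R b"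
  moreover have "b \<in> pres_class R b" by (simp add: pres_class_def pres_eq.refl)
  ultimately have "b \<in> pres_class R a" by simp
  then show "pres_eq R a b" by (simp add: pres_class_def)
next
  assume ab: "pres_eq R a b"
  have "pres_eq R a c \<longleftrightarrow> pres_eq R b c" for c
    using pres_eq.trans[OF ab] pres_eq.trans[OF pres_eq.sym[OF ab]] by blast
  then show "pres_class R a = pres_class R b" by (simp add: pres_class_def)
qed

lemma pres_class_mult:
  "pres_class R a \<otimes>\<^bsub>presented_group R\<^esub> pres_class R b = pres_class R (a @ b)"
proof -
  have "pres_class R (a' @ b') = pres_class R (a @ b)"
    if "a' \<in> pres_class R a" "b' \<in> pres_class R b" for a' b'
    using that unfolding pres_class_eq_iff
    by (simp add: pres_class_def pres_eq.append pres_eq.sym)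
  moreover have "a \<in> pres_class R a" "b \<in> pres_class R b"
    by (simp_all add: pres_class_def pres_eq.refl)
  ultimately have "(\<Union>a'\<in>pres_class R a. \<Union>b'\<in>pres_class R b. pres_class R (a' @ b')) =
      pres_class R (a @ b)"
    by blast
  then show ?thesis
    by (simp add: presented_group_def)
qed

lemma winv_left: "pres_eq R (winv a @ a) []"
proof (induction a)
  case Nil
  show ?case by (simp add: winv_def pres_eq.refl)
next
  case (Cons x a)
  have "pres_eq R [letter_inv x, x] []"
    using pres_eq.cancel[of R "letter_inv x"] by (cases x) auto
  then have "pres_eq R (winv a @ [letter_inv x, x] @ a) (winv a @ [] @ a)"
    by (intro pres_eq.append pres_eq.refl)
  then have "pres_eq R (winv (x # a) @ x # a) (winv a @ a)" by (simp add: winv_def)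
  then show ?case by (rule pres_eq.trans) (rule Cons)
qed

lemma group_presented_group: "group (presented_group R)"
proof (rule groupI)
  show "\<one>\<^bsub>presented_group R\<^esub> \<in> carrier (presented_group R)"
    by (simp add: presented_group_def)
next
  fix x y
  assume "x \<in> carrier (presented_group R)" "y \<in> carrier (presented_group R)"
  then obtain a b where "x = pres_class R a" "y = pres_class R b"
    by (auto simp: presented_group_def)
  then show "x \<otimes>\<^bsub>presented_group R\<^esub> y \<in> carrier (presented_group R)"
    by (simp add: pres_class_mult) (simp add: presented_group_def)
next
  fix x y z
  assume "x \<in> carrier (presented_group R)" "y \<in> carrier (presented_group R)"
    "z \<in> carrier (presented_group R)"
  then obtain a b c where "x = pres_class R a" "y = pres_class R b" "z = pres_class R c"
    by (auto simp: presented_group_def)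
  then show "x \<otimes>\<^bsub>presented_group R\<^esub> y \<otimes>\<^bsub>presented_group R\<^esub> z =
      x \<otimes>\<^bsub>presented_group R\<^esub> (y \<otimes>\<^bsub>presented_group R\<^esub> z)"
    by (simp add: pres_class_mult)
next
  fix x assume "x \<in> carrier (presented_group R)"
  then obtain a where a: "x = pres_class R a" by (auto simp: presented_group_def)
  have one: "\<one>\<^bsub>presented_group R\<^esub> = pres_class R []" by (simp add: presented_group_def)
  show "\<one>\<^bsub>presented_group R\<^esub> \<otimes>\<^bsub>presented_group R\<^esub> x = x"
    by (simp add: one a pres_class_mult)
  show "\<exists>y\<in>carrier (presented_group R). y \<otimes>\<^bsub>presented_group R\<^esub> x = \<one>\<^bsub>presented_group R\<^esub>"
  proof
    show "pres_class R (winv a) \<otimes>\<^bsub>presented_group R\<^esub> x = \<one>\<^bsub>presented_group R\<^esub>"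
      by (simp add: one a pres_class_mult pres_class_eq_iff winv_left)
  qed (simp add: presented_group_def)
qed

fun letter_val :: "('h, 'm) monoid_scheme \<Rightarrow> ('g \<Rightarrow> 'h) \<Rightarrow> 'g letter \<Rightarrow> 'h" where
  "letter_val H f (Pos x) = f x"
| "letter_val H f (Neg x) = inv\<^bsub>H\<^esub> (f x)"

definition word_val :: "('h, 'm) monoid_scheme \<Rightarrow> ('g \<Rightarrow> 'h) \<Rightarrow> 'g word \<Rightarrow> 'h" where
  "word_val H f w = foldr (\<lambda>x h. letter_val H f x \<otimes>\<^bsub>H\<^esub> h) w \<one>\<^bsub>H\<^esub>"

text \<open>The universal property that characterizes \<open>presented_group\<close>.\<close>

lemma presented_group_universal:
  assumes H: "group H" and f: "\<And>x. f x \<in> carrier H"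
    and R: "\<And>l r. (l, r) \<in> R \<Longrightarrow> word_val H f l = word_val H f r"
  shows "\<exists>h \<in> hom (presented_group R) H. \<forall>x. h (pres_class R [Pos x]) = f x"
proof -
  interpret H: group H by (rule H)
  have lc: "letter_val H f x \<in> carrier H" for x
    by (cases x) (auto simp: f)
  have wc: "word_val H f w \<in> carrier H" for w
    by (induction w) (auto simp: word_val_def lc)
  have app: "word_val H f (a @ b) = word_val H f a \<otimes>\<^bsub>H\<^esub> word_val H f b" for a b
  proof (induction a)
    case Nil
    show ?case using wc[of b] by (simp add: word_val_def)
  next
    case (Cons x a)
    then show ?case using wc[of a] wc[of b] lc[of x] by (simp add: word_val_def H.m_assoc)
  qed
  have eq: "word_val H f a = word_val H f b" if "pres_eq R a b" for a b
    using that
  proof induction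
    case (cancel x)
    show ?case by (cases x) (simp_all add: word_val_def f)
  qed (simp_all add: app R)
  define h where "h A = word_val H f (SOME a. a \<in> A)" for A
  have h: "h (pres_class R a) = word_val H f a" for a
  proof -
    have "(SOME b. b \<in> pres_class R a) \<in> pres_class R a"
      by (rule someI[of _ a]) (simp add: pres_class_def pres_eq.refl)
    then show ?thesis by (simp add: h_def pres_class_def eq)
  qed
  have "h \<in> hom (presented_group R) H"
  proof (rule homI)
    fix x assume "x \<in> carrier (presented_group R)"
    then show "h x \<in> carrier H" by (auto simp: presented_group_def h wc)
  next
    fix x y assume "x \<in> carrier (presented_group R)" "y \<in> carrier (presented_group R)"
    then obtain a b where "x = pres_class R a" "y = pres_class R b"
      by (auto simp: presented_group_def)
    then show "h (x \<otimes>\<^bsub>presented_group R\<^esub> y) = h x \<otimes>\<^bsub>H\<^esub> h y"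
      by (simp add: pres_class_mult h app)
  qed
  moreover have "h (pres_class R [Pos x]) = f x" for x
    by (simp add: h word_val_def f)
  ultimately show ?thesis by blast
qed


section \<open>The projective plane over a field\<close>

definition primitive_element :: "'a::field \<Rightarrow> bool" where
  "primitive_element \<zeta> \<longleftrightarrow> \<zeta> \<noteq> 0 \<and> (\<forall>x. x \<noteq> 0 \<longrightarrow> (\<exists>n::nat. x = \<zeta> ^ n))"

definition proj_point :: "'a::field ^ 3 \<Rightarrow> ('a ^ 3) set" where
  "proj_point v = {c *s v | c. c \<noteq> 0}"

definition proj_plane :: "('a::field ^ 3) set set" where
  "proj_plane = {proj_point v | v. v \<noteq> 0}"

definition proj_map :: "('a::field ^ 3 \<Rightarrow> 'a ^ 3) \<Rightarrow> ('a ^ 3) set \<Rightarrow> ('a ^ 3) set" where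
  "proj_map f p = (\<Union>v\<in>p. proj_point (f v))"

lemma proj_map_proj_point:
  assumes "\<And>c. c \<noteq> 0 \<Longrightarrow> \<exists>d. d \<noteq> 0 \<and> f (c *s v) = d *s f v"
  shows "proj_map f (proj_point v) = proj_point (f v)"
proof -
  have scale: "proj_point (d *s w) = proj_point w" if "d \<noteq> 0" for d and w :: "'a ^ 3"
  proof -
    have "\<exists>c'. c *s (d *s w) = c' *s w \<and> c' \<noteq> 0" if "c \<noteq> 0" for c
      using that \<open>d \<noteq> 0\<close> by (intro exI[of _ "c * d"]) (simp add: vector_smult_assoc)
    moreover have "\<exists>c'. c *s w = c' *s (d *s w) \<and> c' \<noteq> 0" if "c \<noteq> 0" for c
      using that \<open>d \<noteq> 0\<close> by (intro exI[of _ "c / d"]) (simp add: vector_smult_assoc)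
    ultimately show ?thesis unfolding proj_point_def by blast
  qed
  have "proj_point (f u) = proj_point (f v)" if "u \<in> proj_point v" for u
    using that assms scale unfolding proj_point_def[of v] by force
  moreover have "v \<in> proj_point v"
    unfolding proj_point_def by (auto intro: exI[of _ 1])
  ultimately show ?thesis unfolding proj_map_def by blast
qed


section \<open>The Mathieu group of degree 24\<close>

datatype 'a ext_point = Pt "('a ^ 3) set" | new_u | new_v | new_w

definition ext_plane :: "'a::field ext_point set" where
  "ext_plane = Pt ` proj_plane \<union> {new_u, new_v, new_w}"

text \<open>\<open>restrict\<close> is needed because the elements of \<open>BijGroup S\<close> are extensional on \<open>S\<close>; its
  product is \<open>g \<otimes> f = g \<circ> f\<close>, i.e. composition from right to left.\<close>

definition matrix_perm :: "'a::field ^ 3 ^ 3 \<Rightarrow> 'a ext_point \<Rightarrow> 'a ext_point" where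
  "matrix_perm A = restrict
    (\<lambda>p. case p of Pt q \<Rightarrow> Pt (proj_map ((*v) A) q)
                 | new_u \<Rightarrow> new_u | new_v \<Rightarrow> new_v | new_w \<Rightarrow> new_w) ext_plane"

definition PSL3 :: "('a::field ext_point \<Rightarrow> 'a ext_point) set" where
  "PSL3 = {matrix_perm A | A. det A = 1}"

datatype m24_symbol = sym_s | sym_j | sym_t | sym_r | sym_u | sym_v | sym_w

fun m24_perm :: "'a::field \<Rightarrow> m24_symbol \<Rightarrow> 'a ext_point \<Rightarrow> 'a ext_point" where
  "m24_perm \<zeta> sym_s = matrix_perm (vector
    [vector [1, 1, 0],
     vector [0, 1, 0],
     vector [0, 0, 1]])"
| "m24_perm \<zeta> sym_j = matrix_perm (vector
    [vector [0, 1, 0],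
     vector [1, 0, 0],
     vector [0, 0, 1]])"
| "m24_perm \<zeta> sym_t = matrix_perm (vector
    [vector [0, 0, 1],
     vector [0, 1, 0],
     vector [1, 0, 0]])"
| "m24_perm \<zeta> sym_r = matrix_perm (vector
    [vector [\<zeta>, 0, 0],
     vector [0, 1, 0],
     vector [0, 0, inverse \<zeta>]])"
| "m24_perm \<zeta> sym_u = restrict
    (\<lambda>p. case p of
       Pt q \<Rightarrow> (if q = proj_point (vector [1, 0, 0]) then new_u
               else Pt (proj_map (\<lambda>a. vector [(a$1)\<^sup>2 + a$2 * a$3, (a$2)\<^sup>2, (a$3)\<^sup>2]) q))
     | new_u \<Rightarrow> Pt (proj_point (vector [1, 0, 0])) | new_v \<Rightarrow> new_v | new_w \<Rightarrow> new_w)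
    ext_plane"
| "m24_perm \<zeta> sym_v = restrict
    (\<lambda>p. case p of
       Pt q \<Rightarrow> Pt (proj_map (\<lambda>a. vector [(a$1)\<^sup>2, (a$2)\<^sup>2, \<zeta> * (a$3)\<^sup>2]) q)
     | new_u \<Rightarrow> new_v | new_v \<Rightarrow> new_u | new_w \<Rightarrow> new_w)
    ext_plane"
| "m24_perm \<zeta> sym_w = restrict
    (\<lambda>p. case p of
       Pt q \<Rightarrow> Pt (proj_map (\<lambda>a. vector [(a$1)\<^sup>2, (a$2)\<^sup>2, (a$3)\<^sup>2]) q)
     | new_u \<Rightarrow> new_u | new_v \<Rightarrow> new_w | new_w \<Rightarrow> new_v)
    ext_plane"

definition M24 :: "'a::field \<Rightarrow> ('a ext_point \<Rightarrow> 'a ext_point) monoid" where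
  "M24 \<zeta> = (BijGroup ext_plane)
    \<lparr>carrier := generate (BijGroup ext_plane)
       (PSL3 \<union> {m24_perm \<zeta> sym_u, m24_perm \<zeta> sym_v, m24_perm \<zeta> sym_w})\<rparr>"

definition m24_relations :: "(m24_symbol word \<times> m24_symbol word) set" where
  "m24_relations =
    (let s = [Pos sym_s]; j = [Pos sym_j]; t = [Pos sym_t]; r = [Pos sym_r];
         u = [Pos sym_u]; v = [Pos sym_v]; w = [Pos sym_w] in
      {(wpow s 2, []),
       (wpow j 2, []),
       (wpow t 2, []),
       (wpow r 3, []),
       (wpow (j @ r) 2, []),
       (wpow (t @ r) 2, []),
       (wpow (s @ r) 3, []),
       (wpow (j @ s) 3, []),
       (wpow (t @ j) 3, []),
       (wpow (t @ s @ t @ j @ s) 3, []),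
       (t @ s @ t @ j @ r @ t @ s @ t,
        r @ s @ winv r @ j @ r @ t @ s @ t @ r @ s @ winv r @ j @ winv r @ s @ winv r)} \<union>
      {(wpow u 2, []),
       (wpow (u @ s) 2, []),
       (wpow (u @ j) 3, []),
       (wconj r u, wconj r j),
       (wconj s (t @ u), s @ wconj s t),
       (wconj s (j @ t @ u), wconj s (j @ t) @ wconj s (t @ j @ t))} \<union>
      {(wpow v 2, []),
       (wpow (v @ s) 2, []),
       (wpow (v @ u) 3, []),
       (wpow (v @ j) 2, []),
       (wpow (v @ r) 2, []),
       (wconj s (t @ v), wconj s (t @ r)),
       (wconj s (j @ t @ v), wconj s (j @ t @ r))} \<union>
      {(wpow w 2, []),
       (wpow (w @ r) 2, []),
       (wpow (w @ s) 2, []),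
       (wpow (w @ j) 2, []),
       (wpow (w @ u) 2, []),
       (wpow (w @ wconj s t) 2, []),
       (wpow (w @ wconj s (j @ t)) 2, []),
       (wpow (w @ v) 3, [])})"

end

(* The relations hold for the given permutations by evaluation on the 24 points, and SL(3,4) is
   generated by the four matrices by Gaussian elimination, so only injectivity needs an argument.
   It follows a stabilizer chain M24 > M23 > M22 > L = PSL(3,4) > P > Q inside the presented group.
   If H is generated by the symbols before u, v or w, and x is that symbol, then x normalizes the
   previous group K, H is the union of K and KyK for the previous symbol y, and xyx = yxy; hence
   H and HxH together are closed under multiplication. Since H fixes a point that x moves,
   an element acting trivially lies in H. At the bottom of the chain one needs the commutator
   relations between the root subgroups of PSL(3,4), which have to be extracted from the two
   relations (tstjs)^3 = 1 and tst jr tst = ... *)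
theory Submission
  imports Defs
begin

section \<open>The root subgroups of the presented linear group\<close>

text \<open>The coset step rests on x * (k * y * k') * x = (x * k * x) * (y * x * y) * (x * k' * x):
  the outer factors stay in H when x carries K into H by conjugation, so the product lies in HxH.
  One representative suffices when the group below has just two double cosets, as for a doubly
  transitive action. At the bottom this fails: on the 20 points other than [1,0,0] the group Q has
  orbits of lengths 1, 3 and 16. Hence P needs the two representatives \<open>s\<close> and
  \<open>n\<close>, and its decomposition comes from a Bruhat computation with products of root
  subgroups. The obstacle there is that the second of the two long relations gives a commutator of
  \<open>s\<close> with \<open>cr b\<close> only. Conjugation by \<open>r\<close> moves both factors
  of a commutator at once, so the consequence that \<open>s\<close> commutes with \<open>a2\<close>
  reaches only three of the nine pairs between the root subgroups of E_12 and E_32. What may go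
  wrong with the other pairs is concentrated in one element \<open>w\<close>, and the other long
  relation is brought in to show \<open>w = 1\<close>. No group order is computed anywhere;
  injectivity is read off from five points.\<close>

lemma mult_eqI2: "a * b = c \<Longrightarrow> a * (b * y) = c * y" for a :: "'g::semigroup_mult"
  by (simp add: mult.assoc[symmetric])
text \<open>With products associated to the right, an equation for a short word must also apply in
  front of a remaining factor; these two rules turn it into such a rewrite rule.\<close>

lemma mult_eqI3: "a * b * c = d \<Longrightarrow> a * (b * (c * y)) = d * y" for a :: "'g::semigroup_mult"
  by (simp add: mult.assoc[symmetric])

text \<open>The hypotheses are the relations x^2 = r^3 = (x r)^3 = 1 of the alternating group A_4,
  in which x and its two conjugates by powers of r are the involutions of a Klein
  four-group.\<close>

lemma A4_group:
  fixes x r R :: "'g::monoid_mult"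
  assumes x: "x * x = 1" and r: "r * R = 1" "R * r = 1" "r * r = R" and xr: "x * r * x = R * x * R"
  shows "x * (r * x * R) = R * x * r" "(r * x * R) * x = R * x * r"
    and "x * (R * x * r) = r * x * R" "(R * x * r) * x = r * x * R"
    and "(r * x * R) * (R * x * r) = x" "(R * x * r) * (r * x * R) = x"
    and "x * R * x = r * x * r"
proof -
  have R: "R * R = r" using r by (metis mult.assoc mult_1_right)
  note [simp] = x r xr R x[THEN mult_eqI2] r[THEN mult_eqI2] R[THEN mult_eqI2] xr[THEN mult_eqI3]
  have "x * R * x = (x * r * x) * (x * r * x)" by (simp add: mult.assoc del: xr)
  also have "\<dots> = r * x * r" unfolding xr by (simp add: mult.assoc)
  finally have xR: "x * R * x = r * x * r" .
  note [simp] = xR xR[THEN mult_eqI3] xR[unfolded mult.assoc] xr[unfolded mult.assoc]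
  show "x * R * x = r * x * r" by fact
  show "x * (r * x * R) = R * x * r" "(r * x * R) * x = R * x * r"
    and "x * (R * x * r) = r * x * R" "(R * x * r) * x = r * x * R"
    and "(r * x * R) * (R * x * r) = x" "(R * x * r) * (r * x * R) = x"
    by (simp_all add: mult.assoc)
qed

lemma invol_commute:
  fixes x y :: "'g::monoid_mult"
  assumes "x * x = 1" "y * y = 1" "(x * y) * (x * y) = 1"
  shows "x * y = y * x"
proof -
  have "x * y = x * (x * y * (x * y)) * y" using assms(3) by simp
  also have "\<dots> = (x * x) * (y * x) * (y * y)" by (simp only: mult.assoc)
  finally show ?thesis using assms(1,2) by simp
qed

lemma klein:
  fixes x y z :: "'g::monoid_mult"
  assumes "x * x = 1" "y * y = 1" "z * z = 1" "x * y = z"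
  shows "y * x = z" "x * z = y" "z * x = y" "y * z = x" "z * y = x"
proof -
  have "x * y = y * x" using assms by (intro invol_commute) simp_all
  then show 1: "y * x = z" using assms by simp
  show "x * z = y" "z * y = x" using assms(1,2) by (simp_all flip: assms(4) add: mult.assoc assms(1,2)[THEN mult_eqI2])
  show "z * x = y" "y * z = x" using assms(1,2) by (simp_all flip: 1 add: mult.assoc assms(1,2)[THEN mult_eqI2])
qed

text \<open>Every generator has finite order, so inverses can be avoided: \<open>R\<close> plays the role of
  \<open>r^{-1}\<close>, and a monoid suffices.\<close>

locale psl34_rels =
  fixes s j t r R :: "'g::monoid_mult"
  assumes ss: "s * s = 1" and jj: "j * j = 1" and tt: "t * t = 1"
    and rR: "r * R = 1" and Rr: "R * r = 1" and rr: "r * r = R"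
    and jr: "j * r * j = R" and tr: "t * r * t = R" and sr: "s * r * s = R * s * R"
    and js: "j * s * j = s * j * s" and tj: "t * j * t = j * t * j"
    and rel_A: "(t * s * t * j * s) * (t * s * t * j * s) * (t * s * t * j * s) = 1"
    and rel_B: "t * s * t * (j * r) * (t * s * t) =
      r * s * R * j * r * (t * s * t) * (r * s * R * j * R * s * R)"
begin

definition cr where "cr x = r * x * R"
definition cs where "cs x = s * x * s"
definition cj where "cj x = j * x * j"
definition ct where "ct x = t * x * t"

lemma RR: "R * R = r"
  using rR rr by (metis mult.assoc mult_1_right)

lemmas orders = ss jj tt rR Rr rr RR
lemmas orders_assoc = orders orders[THEN mult_eqI2]

lemma cr_mult: "cr (x * y) = cr x * cr y" by (simp add: cr_def mult.assoc orders_assoc)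
lemma cs_mult: "cs (x * y) = cs x * cs y" by (simp add: cs_def mult.assoc orders_assoc)
lemma cj_mult: "cj (x * y) = cj x * cj y" by (simp add: cj_def mult.assoc orders_assoc)
lemma ct_mult: "ct (x * y) = ct x * ct y" by (simp add: ct_def mult.assoc orders_assoc)
lemmas conj_mult = cr_mult cs_mult cj_mult ct_mult

lemma conj_one: "cr 1 = 1" "cs 1 = 1" "cj 1 = 1" "ct 1 = 1"
  by (simp_all add: cr_def cs_def cj_def ct_def orders)

lemma conj_cancel: "cr (cr (cr x)) = x" "cs (cs x) = x" "cj (cj x) = x" "ct (ct x) = x"
  by (simp_all add: cr_def cs_def cj_def ct_def mult.assoc orders_assoc)

lemma cr_cr: "cr (cr x) = R * x * r"
  by (simp add: cr_def mult.assoc orders_assoc)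

lemma jR: "j * R * j = r"
proof -
  have "j * R * j = (j * r * j) * (j * r * j)" by (simp add: mult.assoc orders_assoc)
  then show ?thesis by (simp only: jr RR)
qed
lemma tR: "t * R * t = r"
proof -
  have "t * R * t = (t * r * t) * (t * r * t)" by (simp add: mult.assoc orders_assoc)
  then show ?thesis by (simp only: tr RR)
qed

lemma conj_r: "cj r = R" "cj R = r" "ct r = R" "ct R = r" "cr r = r" "cr R = R"
  using jr jR tr tR by (simp_all add: cj_def ct_def cr_def mult.assoc orders_assoc)

text \<open>As \<open>j\<close> and \<open>t\<close> invert \<open>r\<close>, conjugation by them
  turns \<open>cr\<close> into its inverse, which is \<open>cr\<close> applied twice.\<close>

lemma cj_cr: "cj (cr x) = cr (cr (cj x))"
  unfolding cr_cr unfolding cr_def by (simp add: conj_mult conj_r)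
lemma ct_cr: "ct (cr x) = cr (cr (ct x))"
  unfolding cr_cr unfolding cr_def by (simp add: conj_mult conj_r)

text \<open>In \<open>PSL_3(4)\<close> the elements \<open>s\<close>, \<open>a\<close>, \<open>b\<close> are the elementary matrices
  \<open>E_{12}(1)\<close>, \<open>E_{32}(1)\<close>, \<open>E_{31}(1)\<close>, and \<open>n\<close> swaps the last two coordinates. The map
  \<open>cr\<close> multiplies the entry of an elementary matrix by a generator of the multiplicative
  group, so that \<open>x\<close>, \<open>cr x\<close>, \<open>cr (cr x)\<close> are the non-trivial elements of a root
  subgroup.\<close>

abbreviation "a \<equiv> ct s"
abbreviation "b \<equiv> cj a"
abbreviation "n \<equiv> ct j"

lemma aa: "a * a = 1" by (simp flip: ct_mult add: ss conj_one)
lemma bb: "b * b = 1" by (simp flip: cj_mult add: aa conj_one)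
lemma nn: "n * n = 1" by (simp flip: ct_mult add: jj conj_one)

lemma srR: "s * R * s = r * s * r"
  using A4_group(7)[of s r R] orders sr by simp

lemma ar: "a * r * a = R * a * R"
  using arg_cong[OF srR, of ct] by (simp add: conj_mult conj_r)
lemma aR: "a * R * a = r * a * r"
  using A4_group(7)[of a r R] orders aa ar by simp
lemma br: "b * r * b = R * b * R"
  using arg_cong[OF aR, of cj] by (simp add: conj_mult conj_r)

lemma A4_s: "s * cr s = cr (cr s)" "cr s * s = cr (cr s)" "s * cr (cr s) = cr s"
    "cr (cr s) * s = cr s" "cr s * cr (cr s) = s" "cr (cr s) * cr s = s"
  unfolding cr_cr unfolding cr_def using A4_group[of s r R] orders sr by simp_all
lemma A4_a: "a * cr a = cr (cr a)" "cr a * a = cr (cr a)" "a * cr (cr a) = cr a"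
    "cr (cr a) * a = cr a" "cr a * cr (cr a) = a" "cr (cr a) * cr a = a"
  unfolding cr_cr unfolding cr_def by (rule A4_group(1-6)[OF aa orders(4-6) ar])+
lemma A4_b: "b * cr b = cr (cr b)" "cr b * b = cr (cr b)" "b * cr (cr b) = cr b"
    "cr (cr b) * b = cr b" "cr b * cr (cr b) = b" "cr (cr b) * cr b = b"
  unfolding cr_cr unfolding cr_def by (rule A4_group(1-6)[OF bb orders(4-6) br])+

section \<open>Commutators of root elements, extracted from \<open>rel_B\<close> and
  \<open>rel_A\<close>\<close>

lemma cr_invol: "x * x = 1 \<Longrightarrow> cr x * cr x = 1"
  by (simp flip: cr_mult add: conj_one)

text \<open>This is \<open>rel_B\<close> in disguise. Rewriting its last seven letters with
  \<open>js\<close> and the inversion of \<open>r\<close> by \<open>j\<close> gives a * x = s1 * x *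
  s1 for x = \<open>cj (cr a)\<close>; applying \<open>cr\<close> twice turns \<open>cr s\<close>
  into \<open>s\<close> and x into \<open>cr b\<close>.\<close>

lemma cs_b1: "cs (cr b) = cr (cr a) * cr b"
proof -
  have "a * (j * r * a * R * j) = a * (j * r) * a * (R * j)"
    by (simp only: mult.assoc)
  also have "\<dots> = r * s * R * j * r * a * (r * s * R * j * R * s * R) * (R * j)"
    using rel_B by (simp add: ct_def)
  also have "r * s * R * j * R * s * R = R * j * (r * s * r) * j"
  proof -
    have "R * j * (r * s * r) * j = R * cj (r * s * r)" by (simp only: cj_def mult.assoc)
    also have "\<dots> = R * R * cj s * R" by (simp only: conj_mult conj_r mult.assoc)
    also have "\<dots> = r * (s * j * s) * R" by (simp only: cj_def js RR)
    also have "\<dots> = r * s * R * (r * j * r) * (R * s * R)" by (simp only: mult.assoc orders_assoc mult_1_left mult_1_right)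
    also have "r * j * r = j" using jr by (metis rr jr jj rR mult.assoc mult_1 mult_1_right)
    finally show ?thesis by (simp only: mult.assoc)
  qed
  finally have "a * (j * r * a * R * j) = r * s * R * (j * r * a * R * j) * (r * s * R)"
    by (simp only: mult.assoc orders_assoc jR[THEN mult_eqI3] jR[unfolded mult.assoc] mult_1_left mult_1_right)
  then have "a * cj (cr a) = cr s * cj (cr a) * cr s"
    by (simp only: cj_def cr_def mult.assoc)
  from arg_cong[OF this, of "\<lambda>x. cr (cr x)"] show ?thesis
    by (simp only: conj_mult cj_cr conj_cancel cs_def)
qed


text \<open>The automorphism \<open>cs\<close> sends the involution \<open>cr b\<close> to a product
  of two involutions; that product is again an involution, so its factors commute. Applying
  \<open>cs\<close> a second time must return \<open>cr b\<close>, which determines the image of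
  \<open>cr (cr a)\<close>.\<close>

lemma cs_a2: "cs (cr (cr a)) = cr (cr a)" "cr (cr a) * cr b = cr b * cr (cr a)"
proof -
  have i: "(cr (cr a) * cr b) * (cr (cr a) * cr b) = 1"
    using arg_cong[OF cr_invol[OF bb], of cs] by (simp only: cs_mult cs_b1 conj_one)
  show "cr (cr a) * cr b = cr b * cr (cr a)"
    by (rule invol_commute) (simp_all add: i cr_invol aa bb)
  have "cr b = cs (cs (cr b))" by (simp only: conj_cancel)
  also have "\<dots> = cs (cr (cr a)) * (cr (cr a) * cr b)" by (simp only: cs_mult cs_b1)
  finally have "cr b = cs (cr (cr a)) * (cr (cr a) * cr b)" .
  then have "cr b * cr b = cs (cr (cr a)) * (cr (cr a) * cr b) * cr b" by (rule arg_cong)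
  then have "cs (cr (cr a)) * cr (cr a) = 1" by (simp add: cr_invol bb mult.assoc)
  then have "cs (cr (cr a)) * cr (cr a) * cr (cr a) = 1 * cr (cr a)" by (rule arg_cong)
  then have "cs (cr (cr a)) * (cr (cr a) * cr (cr a)) = cr (cr a)" by (simp only: mult.assoc mult_1_left)
  then show "cs (cr (cr a)) = cr (cr a)" by (simp add: cr_invol aa)
qed

abbreviation "a1 \<equiv> cr a"
abbreviation "a2 \<equiv> cr (cr a)"
abbreviation "p \<equiv> cs a"
abbreviation "p1 \<equiv> cr p"
abbreviation "p2 \<equiv> cr p1"
abbreviation "s1 \<equiv> cr s"
abbreviation "s2 \<equiv> cr (cr s)"

lemma s_a2: "s * a2 = a2 * s"
  using cs_a2(1) by (metis cs_def mult.assoc mult_1 ss)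
lemma s1_a: "s1 * a = a * s1"
  using arg_cong[OF s_a2, of cr] by (simp add: conj_mult conj_cancel)
lemma s2_a1: "s2 * a1 = a1 * s2"
  using arg_cong[OF s1_a, of cr] by (simp add: conj_mult conj_cancel)

lemma p_p: "p * p = 1" by (simp flip: cs_mult add: aa conj_one)

text \<open>Here \<open>s2\<close> is \<open>s * s1\<close>, and \<open>s1\<close> commutes with
  \<open>a\<close>, so \<open>s\<close> and \<open>s2\<close> conjugate \<open>a\<close> in the same
  way.\<close>

lemma p_eq: "p = s2 * a * s2"
proof -
  have "s2 * a * s2 = (s * s1) * a * s2" by (simp only: A4_s(1))
  also have "\<dots> = s * (s1 * a) * s2" by (simp only: mult.assoc)
  also have "\<dots> = s * a * (s1 * s2)" by (simp only: s1_a mult.assoc)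
  finally show ?thesis by (simp add: A4_s cs_def)
qed

text \<open>Not a formal identity, since \<open>cr p\<close> is the conjugate of \<open>a1\<close>
  by \<open>s1\<close> rather than by \<open>s\<close>. The two agree because \<open>s\<close> is
  \<open>s1 * s2\<close> and \<open>s2\<close> commutes with \<open>a1\<close>.\<close>

lemma cs_a1: "cs a1 = p1"
proof -
  have "cs a1 = (s1 * s2) * a1 * s" by (simp only: A4_s(5) cs_def)
  also have "\<dots> = s1 * (s2 * a1) * s" by (simp only: mult.assoc)
  also have "\<dots> = s1 * a1 * (s2 * s)" by (simp only: s2_a1 mult.assoc)
  also have "\<dots> = p1" by (simp add: A4_s cs_def conj_mult)
  finally show ?thesis .
qed

lemma p_p1: "p * p1 = a2"
  using arg_cong[OF A4_a(1), of cs] cs_a2(1) by (simp add: conj_mult cs_a1)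
lemma p1_p2: "p1 * p2 = a"
  using arg_cong[OF p_p1, of cr] by (simp add: conj_mult conj_cancel)
lemma a_p1: "a * p1 = p2"
proof -
  have "p2 = s1 * a2 * s1" using arg_cong[OF p_eq, of "\<lambda>x. cr (cr x)"] by (simp add: conj_mult conj_cancel)
  also have "\<dots> = s1 * (a * a1) * s1" by (simp only: A4_a(1))
  also have "\<dots> = (s1 * a) * a1 * s1" by (simp only: mult.assoc)
  also have "\<dots> = a * (s1 * a1 * s1)" by (simp only: s1_a mult.assoc)
  also have "s1 * a1 * s1 = p1" by (simp add: cs_def conj_mult)
  finally show ?thesis by simp
qed
lemma a1_p2: "a1 * p2 = p"
  using arg_cong[OF a_p1, of cr] by (simp add: conj_mult conj_cancel)

lemma invs: "p1 * p1 = 1" "p2 * p2 = 1" "a1 * a1 = 1" "a2 * a2 = 1"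
    "s1 * s1 = 1" "s2 * s2 = 1" "cr b * cr b = 1" "cr (cr b) * cr (cr b) = 1"
  by (simp_all add: cr_invol p_p aa ss bb)

lemmas a_p12 = klein[OF invs(1,2) aa p1_p2]

text \<open>\<open>a\<close> lies in the Klein four-group of \<open>p1\<close> and
  \<open>p2\<close>, so it commutes with \<open>p2\<close>; it also commutes with \<open>a1\<close>,
  and \<open>p\<close> is their product.\<close>

lemma a_p: "a * p = p * a"
proof -
  have "a * p = a * a1 * p2" by (simp add: mult.assoc a1_p2)
  also have "\<dots> = a1 * (a * p2)" by (simp only: A4_a(1) mult.assoc flip: A4_a(2))
  also have "\<dots> = a1 * p2 * a" by (simp only: a_p12 mult.assoc)
  finally show ?thesis by (simp only: a1_p2)
qed

text \<open>The commutator \<open>w\<close> of \<open>s\<close> and \<open>a\<close> and its conjugate \<open>e\<close> measure the failure of the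
  expected relations. The action of \<open>cr s\<close> and \<open>cr (cr s)\<close> on \<open>e\<close> is obtained from that of \<open>s\<close>
  with the same formula, and \<open>cr (cr s) = cr s * s\<close> then forces \<open>w = 1\<close>.\<close>

definition "w = a * p"

lemma ww: "w * w = 1"
proof -
  have "w * w = a * (p * a) * p" by (simp only: w_def mult.assoc)
  also have "\<dots> = (a * a) * (p * p)" by (simp only: a_p[symmetric] mult.assoc)
  finally show ?thesis by (simp only: aa p_p mult_1)
qed

text \<open>The right-hand side is the image of \<open>a * p\<close> under \<open>cr\<close>, so
  this says that \<open>w\<close> commutes with \<open>r\<close>.\<close>

lemma w_eq: "w = a1 * p1"
proof -
  have "w = a1 * (p2 * a)" by (simp only: w_def a_p a1_p2 flip: mult.assoc)
  then show ?thesis by (simp only: a_p12)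
qed

lemma cr_w: "cr w = w"
  by (subst w_def) (simp only: conj_mult w_eq)
lemma cs_w: "cs w = w"
  by (simp only: w_def conj_mult conj_cancel a_p)
lemma p_eq_aw: "p = a * w" 
  by (simp add: w_def aa[THEN mult_eqI2])
lemma a_w: "a * w = w * a"
  unfolding p_eq_aw[symmetric] by (simp add: w_def a_p mult.assoc aa)
lemma p_eq_wa: "p = w * a"
  by (simp only: p_eq_aw a_w)

definition "e = cj w"

lemma ee: "e * e = 1" unfolding e_def by (simp only: cj_mult[symmetric] ww conj_one)
lemma cr_e: "cr e = e"
  using arg_cong[OF cr_w, of "\<lambda>x. cr (cj x)"] unfolding e_def by (simp only: cj_cr conj_cancel)

text \<open>\<open>rel_A\<close> reads (a j s)^3 = 1. Exchanging \<open>j * s * j\<close> for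
  \<open>s * j * s\<close> inside it exhibits \<open>cj p\<close>, which is
  \<open>e * b\<close>.\<close>

lemma cs_b: "a * (e * b) * cs b = 1"
proof -
  have A: "a * j * s * (a * j * s) * (a * j * s) = 1" using rel_A by (simp only: ct_def mult.assoc)
  have "a * cj p * cs b = a * j * s * a * (s * j * s) * j * a * j * s"
    by (simp only: cj_def cs_def mult.assoc)
  also have "\<dots> = a * j * s * a * (j * s * j) * j * a * j * s" by (simp only: js)
  also have "\<dots> = a * j * s * a * j * s * (j * j) * a * j * s" by (simp only: mult.assoc)
  also have "\<dots> = 1" using A by (simp only: jj mult_1_right mult.assoc)
  finally show ?thesis by (simp only: p_eq_wa conj_mult e_def)
qed

lemma cs_b': "cs b = b * e * a"
proof -
  have "b * e * a * (a * (e * b) * cs b) = b * (e * (a * a) * e) * b * cs b" by (simp only: mult.assoc)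
  then show ?thesis by (simp add: cs_b aa ee bb)
qed

text \<open>Apply \<open>cs\<close> to \<open>cs b = b * e * a\<close>: the left side returns to
  \<open>b\<close>, and everything on the right except \<open>cs e\<close> is known.\<close>

lemma cs_e: "cs e = a * e * a * w"
proof -
  have "b = b * e * a * cs e * p"
  proof -
    have "b = cs (b * e * a)" by (simp only: conj_cancel flip: cs_b')
    also have "\<dots> = cs b * cs e * p" by (simp only: conj_mult)
    finally show ?thesis by (simp only: cs_b')
  qed
  then have "a * e * b * b * p = a * e * b * (b * e * a * cs e * p) * p" by (rule arg_cong)
  then have "(a * e * (b * b) * e * a) * cs e * p * p = a * e * b * b * p"
    by (simp only: mult.assoc)
  then have "cs e = a * e * p"
    by (simp add: aa ee bb p_p mult.assoc aa[THEN mult_eqI2] bb[THEN mult_eqI2] ee[THEN mult_eqI2])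
  then show ?thesis by (simp only: p_eq_aw mult.assoc)
qed

lemma w_1: "w = 1"
proof -
  have 1: "s1 * e * s1 = a1 * e * a1 * w"
    using arg_cong[OF cs_e, of cr] by (simp only: conj_mult cr_e cr_w cs_def)
  have 2: "s2 * e * s2 = a2 * e * a2 * w"
    using arg_cong[OF 1, of cr] by (simp only: conj_mult cr_e cr_w)
  have sw: "w * s1 = s1 * w"
  proof -
    have "s1 * w * s1 = w" using arg_cong[OF cs_w, of cr] by (simp only: conj_mult cr_w cs_def)
    then have "s1 * (s1 * w * s1) = s1 * w" by simp
    then show ?thesis by (simp add: invs mult.assoc invs[THEN mult_eqI2])
  qed
  \<comment> \<open>Conjugating by \<open>s\<close> and then by \<open>s1\<close> collects the
    factor \<open>w\<close> twice, and \<open>w * w = 1\<close>; the formula for \<open>s2\<close>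
    obtained by applying \<open>cr\<close> contains it once.\<close>
  have "s2 * e * s2 = (s1 * s) * e * (s * s1)" by (simp only: A4_s)
  also have "\<dots> = s1 * cs e * s1" by (simp only: cs_def mult.assoc)
  also have "\<dots> = s1 * (a * e * a) * (w * s1)" by (simp only: cs_e mult.assoc)
  also have "\<dots> = (s1 * a) * e * (a * s1) * w" by (simp only: sw mult.assoc)
  also have "\<dots> = a * (s1 * e * s1) * a * w" by (simp only: s1_a[symmetric]) (simp only: s1_a mult.assoc)
  also have "\<dots> = (a * a1) * e * a1 * (w * a) * w" by (simp only: 1) (simp only: mult.assoc)
  also have "\<dots> = (a * a1) * e * (a1 * a) * (w * w)" by (simp only: a_w[symmetric] mult.assoc)
  also have "\<dots> = a2 * e * a2" by (simp add: ww A4_a)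
  finally have "a2 * e * a2 * w = a2 * e * a2" using 2 by simp
  then have "a2 * e * a2 * (a2 * e * a2 * w) = a2 * e * a2 * (a2 * e * a2)" by (rule arg_cong)
  then have "a2 * e * (a2 * a2) * e * a2 * w = a2 * e * (a2 * a2) * e * a2" by (simp only: mult.assoc)
  then show ?thesis by (simp add: invs ee mult.assoc invs[THEN mult_eqI2] ee[THEN mult_eqI2])
qed

lemma s_a: "cs a = a" using w_1 p_eq_wa by simp
lemma s_b: "cs b = b * a" using w_1 cs_b' by (simp add: e_def conj_one)
lemma s_b1: "cs (cr b) = cr b * a2" using cs_b1 cs_a2(2) by simp

text \<open>\<open>b * a\<close> is a conjugate of the involution \<open>b\<close>, hence an
  involution itself.\<close>

lemma a_b: "a * b = b * a"
proof -
  have "cs b * cs b = 1" by (simp only: cs_mult[symmetric] bb conj_one)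
  then show ?thesis by (intro invol_commute[symmetric]) (simp_all add: aa bb s_b)
qed

lemma a2_b1: "a2 * cr b = cr b * a2" by (rule cs_a2)
lemma a_b2: "a * cr (cr b) = cr (cr b) * a"
  using arg_cong[OF a2_b1, of cr] by (simp only: conj_mult conj_cancel)
lemma a1_b: "a1 * b = b * a1"
  using arg_cong[OF a_b2, of cr] by (simp only: conj_mult conj_cancel)
lemma a2_b: "a2 * b = b * a2"
proof -
  have "(a * a1) * b = b * (a * a1)" by (metis a1_b a_b mult.assoc)
  then show ?thesis by (simp only: A4_a)
qed
lemma a_b1: "a * cr b = cr b * a"
  using arg_cong[OF a2_b, of cr] by (simp only: conj_mult conj_cancel)

lemma s_b2: "cs (cr (cr b)) = cr (cr b) * a1"
proof -
  have "cs (cr (cr b)) = b * (a * cr b) * a2" by (simp only: A4_b(1)[symmetric] cs_mult s_b s_b1 mult.assoc)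
  also have "\<dots> = (b * cr b) * (a * a2)" by (simp only: a_b1 mult.assoc)
  finally show ?thesis by (simp only: A4_b A4_a)
qed

end

section \<open>Double cosets\<close>

text \<open>Only products are taken, which makes sense in a monoid; for generators of finite order
  this is the generated subgroup.\<close>

inductive_set gen :: "'g::monoid_mult set \<Rightarrow> 'g set" for X where
  gen_one: "1 \<in> gen X"
| gen_mult: "x \<in> X \<Longrightarrow> g \<in> gen X \<Longrightarrow> x * g \<in> gen X"

lemma gen_incl: "x \<in> X \<Longrightarrow> x \<in> gen X"
  using gen_mult[OF _ gen_one] by simp

lemma gen_closed: "g \<in> gen X \<Longrightarrow> h \<in> gen X \<Longrightarrow> g * h \<in> gen X"
  by (induction rule: gen.induct) (simp_all add: mult.assoc gen_mult)

lemma gen_subset: "X \<subseteq> gen Y \<Longrightarrow> gen X \<subseteq> gen Y"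
proof
  fix g assume "X \<subseteq> gen Y" "g \<in> gen X"
  from this(2,1) show "g \<in> gen Y"
    by (induction rule: gen.induct) (auto intro: gen_one gen_closed)
qed

lemma gen_mono: "X \<subseteq> Y \<Longrightarrow> gen X \<subseteq> gen Y"
  by (meson gen_incl gen_subset subsetD subsetI)

lemma gen_conj:
  assumes "x * x = 1" "\<And>y. y \<in> X \<Longrightarrow> x * y * x \<in> gen Z" "g \<in> gen X"
  shows "x * g * x \<in> gen Z"
  using assms(3)
proof induction
  case (gen_mult y g)
  have "x * (y * g) * x = (x * y * x) * (x * g * x)"
    by (simp add: mult.assoc assms(1)[THEN mult_eqI2])
  then show ?case using gen_closed[OF assms(2)[OF gen_mult(1)] gen_mult.IH] by simp
qed (simp add: assms(1) gen_one)

definition dcoset :: "'g::monoid_mult set \<Rightarrow> 'g set \<Rightarrow> 'g set" where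
  "dcoset H Y = H \<union> {g * y * h | g y h. g \<in> H \<and> y \<in> Y \<and> h \<in> H}"

lemma dcosetI: "g \<in> H \<Longrightarrow> y \<in> Y \<Longrightarrow> h \<in> H \<Longrightarrow> g * y * h \<in> dcoset H Y"
  by (auto simp: dcoset_def)

lemma dcoset_mult_left: "g \<in> gen X \<Longrightarrow> h \<in> dcoset (gen X) Y \<Longrightarrow> g * h \<in> dcoset (gen X) Y"
  unfolding dcoset_def using gen_closed[of g X] by (fastforce simp flip: mult.assoc)

lemma dcoset_mult_right: "g \<in> gen X \<Longrightarrow> h \<in> dcoset (gen X) Y \<Longrightarrow> h * g \<in> dcoset (gen X) Y"
  unfolding dcoset_def using gen_closed[of _ X g] by (fastforce simp: mult.assoc)

text \<open>The right-hand side absorbs \<open>gen X\<close> on both sides, so only products x * h *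
  x with h in \<open>gen X\<close> matter. Writing h = q * y * q' splits this into (x * q * x) * (x
  * y * x) * (x * q' * x), whose outer factors lie in \<open>gen X\<close>.\<close>

lemma gen_insert_dcoset:
  assumes x: "x * x = 1"
    and H: "gen X \<subseteq> dcoset Q Y"
    and Q: "\<And>q. q \<in> Q \<Longrightarrow> q \<in> gen X \<and> x * q * x \<in> gen X"
    and Y: "\<And>y. y \<in> Y \<Longrightarrow> x * y * x \<in> dcoset (gen X) {x}"
  shows "gen (insert x X) \<subseteq> dcoset (gen X) {x}"
proof
  fix g assume "g \<in> gen (insert x X)"
  then show "g \<in> dcoset (gen X) {x}"
  proof induction
    case gen_one
    show ?case by (simp add: dcoset_def gen.gen_one)
  next
    case (gen_mult y g)
    show ?case
    proof (cases "y = x")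
      case False
      then show ?thesis using gen_mult by (auto intro!: dcoset_mult_left gen_incl)
    next
      case True
      from \<open>g \<in> dcoset (gen X) {x}\<close> consider "g \<in> gen X"
        | h k where "g = h * x * k" "h \<in> gen X" "k \<in> gen X" unfolding dcoset_def by auto
      then show ?thesis
      proof cases
        case 1
        then show ?thesis using dcosetI[OF gen_one, of x "{x}" g X] True by simp
      next
        case 2
        have "x * h * x \<in> dcoset (gen X) {x}"
        proof -
          from H 2(2) consider "h \<in> Q" | q y q' where "h = q * y * q'" "q \<in> Q" "y \<in> Y" "q' \<in> Q"
            unfolding dcoset_def by auto
          then show ?thesis
          proof cases
            case 1
            then show ?thesis using Q[of h] by (simp add: dcoset_def)
          next
            case 2
            have "x * h * x = (x * q * x) * (x * y * x) * (x * q' * x)"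
              by (simp add: 2 mult.assoc x[THEN mult_eqI2])
            then show ?thesis
              using 2 Q Y by (simp add: dcoset_mult_left dcoset_mult_right)
          qed
        qed
        then have "x * h * x * k \<in> dcoset (gen X) {x}"
          by (rule dcoset_mult_right[OF 2(3)])
        then show ?thesis using True 2 by (simp add: mult.assoc)
      qed
    qed
  qed
qed

section \<open>Products of root subgroups in the stabilizer of [1,0,0]\<close>

context psl34_rels begin

text \<open>Conjugation by \<open>n\<close>, composed from \<open>ct\<close> and \<open>cj\<close>
  so that the rules for those carry over.\<close>

definition cn where "cn x = ct (cj (ct x))"

lemma cn_def': "cn x = n * x * n"
  by (simp add: cn_def ct_def cj_def mult.assoc orders_assoc)

lemma cn_mult: "cn (x * y) = cn x * cn y" by (simp only: cn_def conj_mult)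
lemma cn_cr: "cn (cr x) = cr (cr (cn x))"
  by (simp only: cn_def ct_cr cj_cr conj_cancel)
lemma cn_cn: "cn (cn x) = x" by (simp only: cn_def conj_cancel)

text \<open>These are \<open>E_{13}(1)\<close> and \<open>E_{23}(1)\<close>; \<open>Q\<close> below is the stabilizer of \<open>[1,0,0]\<close> and
  \<open>[0,1,0]\<close>, of order 48, and \<open>S\<close> is the stabilizer of \<open>[1,0,0]\<close>.\<close>

definition "d = cn s"
definition "f = cn a"

lemma n_eq: "n = j * t * j" using tj by (simp add: ct_def)

lemma d_eq: "d = ct b" by (simp add: d_def cn_def)
lemma f_eq: "f = ct (cj s)" by (simp add: f_def cn_def conj_cancel)
lemma cj_d: "cj d = f"
proof -
  have "cj d = j * n * s * n * j" by (simp add: d_def cn_def' cj_def mult.assoc)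
  also have "\<dots> = t * j * s * j * t" unfolding n_eq by (simp add: mult.assoc orders_assoc)
  finally show ?thesis by (simp add: f_eq ct_def cj_def mult.assoc)
qed
lemma cj_f: "cj f = d" using cj_d conj_cancel by metis

lemma cn_one: "cn 1 = 1" by (simp only: cn_def conj_one)
lemma dd: "d * d = 1" unfolding d_def by (simp only: cn_mult[symmetric] ss cn_one)
lemma ff: "f * f = 1" unfolding f_def by (simp only: cn_mult[symmetric] aa cn_one)

text \<open>\<open>cn\<close> after \<open>ct\<close> sends \<open>s\<close>, \<open>b\<close>,
  \<open>a\<close> to \<open>f\<close>, \<open>s\<close>, \<open>d\<close>. Each of the two inverts
  \<open>cr\<close>, so their composition commutes with it, and the three formulas are images of
  \<open>s_b\<close>, \<open>s_b1\<close> and \<open>s_b2\<close>.\<close>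

lemma f_s: "f * s * f = s * d" "f * s1 * f = s1 * cr (cr d)" "f * s2 * f = s2 * cr d"
proof -
  have *: "cn (a * x * a) = f * cn x * f" "ct (cs x) = a * ct x * a" for x
    by (simp_all only: cn_mult f_def cs_def ct_mult)
  note 1 = arg_cong[OF s_b, of "\<lambda>x. cn (ct x)"] arg_cong[OF s_b1, of "\<lambda>x. cn (ct x)"] arg_cong[OF s_b2, of "\<lambda>x. cn (ct x)"]
  note 2 = 1[unfolded * conj_mult cn_mult conj_cancel ct_cr cn_cr, folded d_eq, unfolded d_def cn_cn, folded d_def]
  show "f * s * f = s * d" "f * s1 * f = s1 * cr (cr d)" "f * s2 * f = s2 * cr d"
    using 2 by (simp_all only: f_def)
qed

definition V where "V x = {1, x, cr x, cr (cr x)}"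

lemma V_cr: "y \<in> V x \<Longrightarrow> cr y \<in> V x" by (auto simp: V_def conj_cancel conj_one)

text \<open>Applying \<open>cr\<close> moves x through \<open>V x\<close> while it permutes the
  three partners cyclically, so three of the nine pairs are enough.\<close>

lemma V_commute:
  assumes "x * y = y * x" "x * cr y = cr y * x" "x * cr (cr y) = cr (cr y) * x"
    and "z \<in> V x" "z' \<in> V y"
  shows "z * z' = z' * z"
proof -
  note 1 = arg_cong[OF assms(1), of cr] arg_cong[OF assms(2), of cr] arg_cong[OF assms(3), of cr]
  note 2 = 1[unfolded conj_mult conj_cancel]
  note 3 = 2[THEN arg_cong, of cr, unfolded conj_mult conj_cancel]
  from assms(4,5) show ?thesis unfolding V_def using assms(1-3) 2 3 by auto
qed

lemma V_sd: "x \<in> V s \<Longrightarrow> y \<in> V d \<Longrightarrow> x * y = y * x"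
proof (rule V_commute)
  note 1 = a_b[THEN arg_cong, of ct] a_b2[THEN arg_cong, of ct] a_b1[THEN arg_cong, of ct]
  show "s * d = d * s" "s * cr d = cr d * s" "s * cr (cr d) = cr (cr d) * s"
    by (rule 1[unfolded conj_mult ct_cr conj_cancel, folded d_eq])+
qed

lemma s_a': "a * s = s * a" "s1 * a = a * s1" "s2 * a = a * s2" "a * s1 = s1 * a" "a * s2 = s2 * a"
proof -
  show 1: "a * s = s * a" using s_a aa ss by (metis cs_def mult.assoc mult_1)
  show "s1 * a = a * s1" by (rule s1_a)
  then show "a * s1 = s1 * a" ..
  show "s2 * a = a * s2" using 1 s1_a A4_s(1) by (metis mult.assoc)
  then show "a * s2 = s2 * a" ..
qed

lemma V_fd: "x \<in> V f \<Longrightarrow> y \<in> V d \<Longrightarrow> x * y = y * x"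
proof (rule V_commute)
  note 1 = s_a'(1,5,4)[THEN arg_cong, of cn]
  show "f * d = d * f" "f * cr d = cr d * f" "f * cr (cr d) = cr (cr d) * f"
    by (rule 1[unfolded cn_mult cn_cr conj_cancel, folded f_def d_def])+
qed

definition C where "C = {1, r, R}"
definition "Q = V d * V f * C"

lemma V_V: assumes "x * x = 1" "x * cr x = cr (cr x)" shows "V x * V x = V x"
proof -
  note i = cr_invol[OF assms(1)] cr_invol[OF cr_invol[OF assms(1)]]
  note 1 = klein[OF assms(1) i assms(2)]
  show ?thesis unfolding V_def set_times_def using assms 1 i by auto
qed

lemma n_r: "n * r = R * n" "n * R = r * n"
proof -
  have "cn r = R" "cn R = r" by (simp_all only: cn_def conj_r)
  then have "n * r * n * n = R * n" "n * R * n * n = r * n" by (simp_all only: cn_def')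
  then show "n * r = R * n" "n * R = r * n" by (simp_all add: mult.assoc nn)
qed

lemma r_cr: "r * x = cr x * r" "R * x = cr (cr x) * R" "x * r = r * cr (cr x)" "x * R = R * cr x"
  by (simp_all add: cr_def mult.assoc orders_assoc)

lemma V_C: "C * V x = V x * C"
proof (intro equalityI subsetI)
  fix g assume "g \<in> C * V x"
  then obtain c y where c: "c \<in> C" "y \<in> V x" "g = c * y" by (auto elim: set_times_elim)
  then have "g = y * 1 \<or> g = cr y * r \<or> g = cr (cr y) * R" by (auto simp: C_def r_cr(1,2))
  then show "g \<in> V x * C" using c(2) V_cr[of _ x] by (auto simp only: C_def insert_iff intro!: set_times_intro)
next
  fix g assume "g \<in> V x * C"
  then obtain c y where c: "c \<in> C" "y \<in> V x" "g = y * c" by (auto elim: set_times_elim)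
  then have "g = 1 * y \<or> g = r * cr (cr y) \<or> g = R * cr y" by (auto simp: C_def r_cr(3,4))
  then show "g \<in> C * V x" using c(2) V_cr[of _ x] by (auto simp only: C_def insert_iff intro!: set_times_intro)
qed

lemma V_s: "V s * V s = V s" by (rule V_V[OF ss A4_s(1)])
lemma V_d: "V d * V d = V d"
  by (rule V_V[OF dd]) (use A4_s(3)[THEN arg_cong, of cn] in \<open>simp only: cn_mult cn_cr conj_cancel d_def\<close>)
lemma V_f: "V f * V f = V f"
  by (rule V_V[OF ff]) (use A4_a(3)[THEN arg_cong, of cn] in \<open>simp only: cn_mult cn_cr conj_cancel f_def\<close>)

lemma C_C: "C * C = C"
  by (auto simp: C_def set_times_def orders)

lemma sets_commute:
  fixes A B :: "'g set"
  assumes "\<And>x y. x \<in> A \<Longrightarrow> y \<in> B \<Longrightarrow> x * y = y * x"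
  shows "A * B = B * A"
proof (intro equalityI subsetI)
  fix g
  show "g \<in> B * A" if "g \<in> A * B"
    using that by (elim set_times_elim) (metis assms set_times_intro)
  show "g \<in> A * B" if "g \<in> B * A"
    using that by (elim set_times_elim) (metis assms set_times_intro)
qed

lemma fd_commute: "V f * V d = V d * V f" by (rule sets_commute) (rule V_fd)

text \<open>The commutator formula [E_23, E_12] in E_13. The lemma \<open>f_s\<close> treats all
  partners of \<open>f\<close> in \<open>V s\<close>; \<open>cr\<close> carries these cases to the
  other elements of \<open>V f\<close>.\<close>

lemma f_s_d:
  assumes "y \<in> V f" "x \<in> V s"
  shows "\<exists>z\<in>V d. y * x = x * z * y"
proof -
  have 0: "\<exists>z\<in>V d. f * x = x * z * f" if "f * x * f = x * z" "z \<in> V d" for x z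
    using that by (metis ff mult.assoc mult_1_right)
  have 1: "\<exists>z\<in>V d. cr y * cr x = cr x * z * cr y" if "\<exists>z\<in>V d. y * x = x * z * y" for x y
    using that V_cr by (metis cr_mult)
  have 2: "\<exists>z\<in>V d. f * s = s * z * f" "\<exists>z\<in>V d. f * s1 = s1 * z * f" "\<exists>z\<in>V d. f * s2 = s2 * z * f"
    by (rule 0, rule f_s, simp add: V_def)+
  note 3 = 1[OF 2(1)] 1[OF 2(2)] 1[OF 2(3)]
  note 4 = 1[OF 3(1)] 1[OF 3(2)] 1[OF 3(3)]
  show ?thesis
  proof (cases "y = 1 \<or> x = 1")
    case True
    then show ?thesis by (auto simp: V_def)
  next
    case False
    with assms consider "y = f" "x = s" | "y = f" "x = s1" | "y = f" "x = s2"
      | "y = cr f" "x = s" | "y = cr f" "x = s1" | "y = cr f" "x = s2"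
      | "y = cr (cr f)" "x = s" | "y = cr (cr f)" "x = s1" | "y = cr (cr f)" "x = s2"
      unfolding V_def by blast
    then show ?thesis using 2 3 4 by cases (simp_all only: conj_cancel)
  qed
qed

lemma V_invol: "x * x = 1 \<Longrightarrow> y \<in> V x \<Longrightarrow> y * y = 1"
  by (auto simp: V_def cr_invol)

text \<open>\<open>V s\<close> normalizes \<open>V f * V d\<close> because the commutators with
  \<open>V f\<close> fall into \<open>V d\<close>, and \<open>C\<close> normalizes every root
  subgroup. The product \<open>Q * V s\<close> corresponds to the upper triangular matrices.\<close>

lemma Q_V: "V s * Q = Q * V s"
proof -
  have "V s * (V f * V d) = (V f * V d) * V s"
  proof (intro equalityI subsetI)
    fix g assume "g \<in> V s * (V f * V d)"
    then obtain x y w where g: "x \<in> V s" "y \<in> V f" "w \<in> V d" "g = x * (y * w)" 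
      by (auto elim!: set_times_elim)
    obtain z where z: "z \<in> V d" "y * x = x * z * y" using f_s_d[OF g(2,1)] by blast
    have "x * y = y * (y * x) * y"
      using V_invol[OF ff g(2)] by (simp flip: mult.assoc)
    also have "\<dots> = y * (x * z * y) * y" by (simp only: z(2))
    also have "\<dots> = y * x * z * (y * y)" by (simp only: mult.assoc)
    also have "\<dots> = y * (z * x)" by (simp only: V_invol[OF ff g(2)] mult_1_right mult.assoc V_sd[OF g(1) z(1)])
    finally have "g = y * (z * w) * x"
      by (simp add: g(4) mult.assoc V_sd[OF g(1,3)] flip: mult.assoc) (simp only: mult.assoc V_sd[OF g(1,3)])
    moreover have "z * w \<in> V d" using V_d g z by (metis set_times_intro)
    ultimately show "g \<in> (V f * V d) * V s" using g by (simp add: set_times_intro)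
  next
    fix g assume "g \<in> (V f * V d) * V s"
    then obtain x y w where g: "x \<in> V s" "y \<in> V f" "w \<in> V d" "g = (y * w) * x" 
      by (auto elim!: set_times_elim)
    obtain z where z: "z \<in> V d" "y * x = x * z * y" using f_s_d[OF g(2,1)] by blast
    have "g = (y * x) * w" by (simp only: g(4) mult.assoc V_sd[OF g(1,3)])
    also have "\<dots> = x * (z * y) * w" by (simp only: z(2) mult.assoc)
    also have "z * y = y * z" using V_fd[OF g(2) z(1)] ..
    also have "x * (y * z) * w = x * (y * (z * w))" by (simp only: mult.assoc)
    finally show "g \<in> V s * (V f * V d)" using V_d g z by (metis set_times_intro)
  qed
  then have "V s * (V f * V d) * C = V f * V d * V s * C" by (rule arg_cong)
  then show ?thesis unfolding Q_def fd_commute[symmetric] by (simp only: mult.assoc V_C)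
qed

lemma Q_Q: "Q * Q = Q"
proof -
  have "Q * Q = V d * V f * (C * V d) * V f * C" by (simp only: Q_def mult.assoc)
  also have "\<dots> = V d * (V f * V d) * (C * V f) * C" by (simp only: V_C mult.assoc)
  also have "\<dots> = (V d * V d) * (V f * V f) * (C * C)" by (simp only: V_C fd_commute mult.assoc)
  finally show ?thesis by (simp only: V_d V_f C_C Q_def)
qed

lemma one_in: "1 \<in> V x" "1 \<in> C" "1 \<in> Q"
proof -
  show "1 \<in> V x" "1 \<in> C" for x by (simp_all add: V_def C_def)
  then have "1 * 1 * 1 \<in> Q" unfolding Q_def by (intro set_times_intro)
  then show "1 \<in> Q" by simp
qed

lemma V_subset_Q: "V d \<subseteq> Q" "V f \<subseteq> Q" "C \<subseteq> Q"
proof -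
  have 1: "x * y * c \<in> Q" if "x \<in> V d" "y \<in> V f" "c \<in> C" for x y c
    unfolding Q_def by (intro set_times_intro that)
  show "V d \<subseteq> Q" using 1[OF _ one_in(1) one_in(2)] by auto
  show "V f \<subseteq> Q" using 1[OF one_in(1) _ one_in(2)] by auto
  show "C \<subseteq> Q" using 1[OF one_in(1) one_in(1)] by auto
qed

lemma Q_mult: "x \<in> Q \<Longrightarrow> y \<in> Q \<Longrightarrow> x * y \<in> Q"
  using Q_Q set_times_intro by metis

lemma gens_in_Q: "r \<in> Q" "R \<in> Q" "d \<in> Q" "f \<in> Q"
  using V_subset_Q by (auto simp: V_def C_def)

lemma n_V: "{n} * V s = V d * {n}" "{n} * V d = V s * {n}"
proof -
  have "{n} * V s = V (cn s) * {n}" "{n} * V d = V (cn d) * {n}"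
  proof -
    have 1: "n * x = cn x * n" for x by (simp add: cn_def' mult.assoc nn)
    show "{n} * V s = V (cn s) * {n}" "{n} * V d = V (cn d) * {n}"
      by (auto simp: set_times_def V_def 1 cn_cr conj_cancel cn_one)
  qed
  then show "{n} * V s = V d * {n}" "{n} * V d = V s * {n}" by (simp_all add: d_def cn_cn)
qed

lemma n_C: "{n} * C = C * {n}"
  by (auto simp: set_times_def C_def n_r)

lemma nan: "n * a * n = a * n * a"
  using arg_cong[OF js, of ct] by (simp only: conj_mult)

text \<open>The Bruhat identity of the SL_2 acting on the last two coordinates: a lower unipotent
  element is upper times Weyl element times upper.\<close>

lemma a_eq: "a = f * n * f"
proof -
  have "f * n * f = n * a * (n * n) * (n * a * n)" by (simp only: f_def cn_def' mult.assoc)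
  also have "\<dots> = n * (a * n * a) * n" by (simp only: nn mult_1_right mult.assoc)
  also have "\<dots> = (n * n) * a * (n * n)" by (simp only: nan[symmetric]) (simp only: mult.assoc)
  finally show ?thesis by (simp add: nn)
qed

text \<open>Conjugation by \<open>n\<close> takes \<open>V f\<close> out of \<open>Q\<close>, to the
  root subgroup of \<open>a\<close>. By \<open>a_eq\<close> the element \<open>a\<close> lies in the
  double coset of \<open>n\<close>; the other two elements follow since \<open>r\<close> and
  \<open>R\<close> lie in \<open>Q\<close>.\<close>

lemma n_f_n: "{n} * V f * {n} \<subseteq> Q \<union> Q * {n} * Q"
proof -
  have 0: "cr x \<in> Q * {n} * Q" if "x \<in> Q * {n} * Q" for x
  proof -
    from that obtain q q' where q: "x = q * n * q'" "q \<in> Q" "q' \<in> Q" by (auto elim!: set_times_elim)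
    have "cr x = (r * q) * n * (q' * R)" by (simp add: cr_def q mult.assoc)
    then show ?thesis using q gens_in_Q Q_mult by (auto intro!: set_times_intro)
  qed
  have 1: "a \<in> Q * {n} * Q" unfolding a_eq by (intro set_times_intro gens_in_Q) simp
  have "n * y * n \<in> Q \<union> Q * {n} * Q" if "y \<in> V f" for y
  proof -
    have "cn f = a" by (simp add: f_def cn_cn)
    then have "cn y \<in> {1, a, a1, a2}" using that by (auto simp: V_def cn_cr conj_cancel cn_one)
    then show ?thesis using 1 0[OF 1] 0[OF 0[OF 1]] one_in unfolding cn_def' by auto
  qed
  then show ?thesis by (auto elim!: set_times_elim)
qed

end

lemma braid_dcoset: "x * y * x = y * x * y \<Longrightarrow> y \<in> gen X \<Longrightarrow> x * y * x \<in> dcoset (gen X) {x}"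
  by (simp add: dcosetI)

section \<open>Bruhat decomposition of the point stabilizer, and the step up to PSL_3(4)\<close>

context psl34_rels begin

text \<open>Two Bruhat cells: the upper triangular group and the cell of \<open>n\<close>. In the
  second one no factor \<open>V s\<close> appears, since it can be moved past \<open>n\<close>,
  where it becomes \<open>V d\<close> and is absorbed by \<open>Q\<close>.\<close>

definition S where "S = Q * V s \<union> Q * {n} * Q"

lemma n_V': "{n} * (V s * X) = V d * ({n} * X)" "{n} * (V d * X) = V s * ({n} * X)"
  by (simp_all only: mult.assoc[symmetric] n_V)
lemma Q_V_d: "Q * V d = Q" "V d * Q = Q" 
proof -
  have "Q * V d \<subseteq> Q * Q" "V d * Q \<subseteq> Q * Q"
    using V_subset_Q by (intro set_times_mono2 subset_refl; simp)+
  then have "Q * V d \<subseteq> Q" "V d * Q \<subseteq> Q" by (simp_all only: Q_Q)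
  moreover have "Q \<subseteq> Q * V d" "Q \<subseteq> V d * Q"
    using set_times_intro[OF _ one_in(1)[of d]] set_times_intro[OF one_in(1)[of d]] by auto
  ultimately show "Q * V d = Q" "V d * Q = Q" by blast+
qed

lemma Q_S: "q \<in> Q \<Longrightarrow> g \<in> S \<Longrightarrow> q * g \<in> S"
proof -
  have "Q * S = S"
    by (simp only: S_def set_times_Un_distrib mult.assoc[symmetric] Q_Q)
  then show "q \<in> Q \<Longrightarrow> g \<in> S \<Longrightarrow> q * g \<in> S" by (metis set_times_intro)
qed

lemma V_S: "V s * S = S"
proof -
  have "V s * (Q * V s) = Q * V s"
    by (simp only: mult.assoc[symmetric] Q_V) (simp only: mult.assoc V_s)
  moreover have "V s * (Q * {n} * Q) = Q * {n} * Q"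
  proof -
    have "V s * (Q * {n} * Q) = Q * (V s * {n}) * Q"
      by (simp only: mult.assoc[symmetric] Q_V)
    also have "\<dots> = Q * {n} * (V d * Q)"
      by (simp only: mult.assoc n_V[symmetric])
    finally show ?thesis by (simp only: Q_V_d)
  qed
  ultimately show ?thesis by (simp only: S_def set_times_Un_distrib)
qed

text \<open>\<open>n\<close> exchanges \<open>V s\<close> with \<open>V d\<close> and normalizes
  \<open>C\<close>. Everything therefore passes through it except \<open>V f\<close>, for which
  \<open>n_f_n\<close> is used.\<close>

lemma n_S: "{n} * S \<subseteq> S"
proof -
  have Q: "Q = C * V d * V f" 
    by (simp only: Q_def V_C mult.assoc)
  have "{n} * (Q * V s) = {n} * (V s * Q)" by (simp only: Q_V)
  also have "\<dots> = V d * {n} * Q" by (simp only: n_V' mult.assoc)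
  also have "\<dots> \<subseteq> Q * {n} * Q" by (intro set_times_mono2 subset_refl V_subset_Q)
  finally have 1: "{n} * (Q * V s) \<subseteq> S" by (auto simp: S_def)
  have "{n} * (Q * {n} * Q) = ({n} * C) * V d * V f * {n} * Q" by (simp only: Q mult.assoc)
  also have "\<dots> = C * V s * ({n} * V f * {n}) * Q" by (simp only: n_C n_V' mult.assoc)
  also have "\<dots> \<subseteq> C * V s * (Q \<union> Q * {n} * Q) * Q"
    by (intro set_times_mono2 subset_refl n_f_n)
  also have "\<dots> = C * (V s * (Q \<union> Q * {n} * Q))"
    by (simp only: set_times_Un_distrib mult.assoc Q_Q)
  also have "\<dots> \<subseteq> C * (V s * S)"
  proof (intro set_times_mono2 subset_refl)
    have "Q \<subseteq> Q * V s" using set_times_intro[OF _ one_in(1)[of s]] by auto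
    then show "Q \<union> Q * {n} * Q \<subseteq> S" by (auto simp: S_def)
  qed
  also have "\<dots> \<subseteq> S"
    using V_subset_Q(3) Q_S by (auto simp: V_S elim!: set_times_elim)
  finally show ?thesis using 1 by (simp only: S_def set_times_Un_distrib Un_least)
qed

lemma S_subset: "S \<subseteq> dcoset Q {s, n}"
proof
  fix g assume "g \<in> S"
  then consider q x where "g = q * x" "q \<in> Q" "x \<in> V s" | q q' where "g = q * n * q'" "q \<in> Q" "q' \<in> Q"
    by (auto simp: S_def elim!: set_times_elim)
  then show "g \<in> dcoset Q {s, n}"
  proof cases
    case 1
    \<comment> \<open>\<open>s1\<close> and \<open>s2\<close> are conjugates of \<open>s\<close> by
      elements of \<open>C\<close>, so they need no representatives of their own.\<close>
    then have "g = q \<or> g = q * s * 1 \<or> g = (q * r) * s * R \<or> g = (q * R) * s * r"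
      by (auto simp: V_def cr_cr) (auto simp: cr_def mult.assoc)
    moreover have "q \<in> dcoset Q {s, n}" using 1 by (simp add: dcoset_def)
    moreover have "q * s * 1 \<in> dcoset Q {s, n}" "(q * r) * s * R \<in> dcoset Q {s, n}"
      "(q * R) * s * r \<in> dcoset Q {s, n}"
      by (intro dcosetI Q_mult 1(2) gens_in_Q one_in insertI1)+
    ultimately show ?thesis by metis
  next
    case 2
    then show ?thesis by (auto intro: dcosetI)
  qed
qed

lemma Q_gen: "Q \<subseteq> gen {r, d, f}"
proof -
  have g: "r \<in> gen {r, d, f}" "d \<in> gen {r, d, f}" "f \<in> gen {r, d, f}"
    by (simp_all add: gen_incl)
  have R: "R \<in> gen {r, d, f}" using gen_closed[OF g(1,1)] by (simp add: rr)
  have "V x \<subseteq> gen {r, d, f}" if "x \<in> gen {r, d, f}" for x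
    using that g R by (auto simp: V_def cr_def gen_closed gen_one)
  moreover have "C \<subseteq> gen {r, d, f}" using g R by (auto simp: C_def gen_one)
  ultimately show ?thesis
    using g by (auto simp: Q_def elim!: set_times_elim intro!: gen_closed)
qed

abbreviation "gens_P \<equiv> {n, r, s, d, f}"

text \<open>\<open>S\<close> contains 1 and is closed under left multiplication by every generator,
  so it contains all products of them.\<close>

lemma P_dcoset: "gen gens_P \<subseteq> dcoset Q {s, n}"
proof -
  have "g \<in> S" if "g \<in> gen gens_P" for g
    using that
  proof induction
    case gen_one
    have "1 * 1 \<in> Q * V s" by (intro set_times_intro one_in)
    then show ?case by (simp add: S_def)
  next
    case (gen_mult x g)
    have "s * g \<in> V s * S" "n * g \<in> {n} * S"
      using gen_mult by (auto intro!: set_times_intro simp: V_def)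
    then have "s * g \<in> S" "n * g \<in> S" using V_S n_S by auto
    then show ?case using gen_mult Q_S gens_in_Q by auto
  qed
  then show ?thesis using S_subset by blast
qed

text \<open>\<open>j\<close> interchanges [1,0,0] and [0,1,0], which is why it normalizes
  \<open>Q\<close>: it swaps \<open>d\<close> with \<open>f\<close> and inverts \<open>r\<close>. It
  satisfies a braid relation with both representatives.\<close>

lemma L_dcoset: "gen (insert j gens_P) \<subseteq> dcoset (gen gens_P) {j}"
proof (rule gen_insert_dcoset[OF jj P_dcoset])
  fix q assume "q \<in> Q"
  then have "q \<in> gen {r, d, f}" using Q_gen by blast
  moreover have "gen {r, d, f} \<subseteq> gen gens_P" by (rule gen_mono) auto
  moreover have "j * q * j \<in> gen {r, d, f}" 
  proof (rule gen_conj[OF jj _ \<open>q \<in> gen {r, d, f}\<close>])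
    have "j * d * j = f" "j * f * j = d" using cj_d cj_f by (simp_all add: cj_def)
    then show "y \<in> {r, d, f} \<Longrightarrow> j * y * j \<in> gen {r, d, f}" for y
      using jr gens_in_Q(2) Q_gen by (auto simp: gen_incl)
  qed
  ultimately show "q \<in> gen gens_P \<and> j * q * j \<in> gen gens_P" by blast
next
  fix y assume "y \<in> {s, n}"
  moreover have "j * s * j = s * j * s" by (rule js)
  moreover have "j * n * j = n * j * n"
  proof -
    have "j * n * j = t" by (simp add: n_eq mult.assoc orders_assoc)
    moreover have "n * j * n = t * (j * t * j) * t * j * t" by (simp add: ct_def mult.assoc)
    moreover have "\<dots> = t" by (simp only: tj[symmetric]) (simp add: mult.assoc orders_assoc)
    ultimately show ?thesis by simp
  qed
  ultimately show "j * y * j \<in> dcoset (gen gens_P) {j}"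
    using braid_dcoset[of j s] braid_dcoset[of j n] by (auto simp: gen_incl)
qed

end

section \<open>Extension of the chain by \<open>u\<close>, \<open>v\<close> and \<open>w'\<close>
  (the name \<open>w\<close> is taken by the commutator)\<close>

locale m24_rels = psl34_rels s j t r R for s j t r R :: "'g::monoid_mult" +
  fixes u v w' :: 'g
  assumes uu: "u * u = 1" and us: "u * s * u = s" and uj: "u * j * u = j * u * j"
    and ur: "u * r * u = R" and u_st: "u * (t * s * t) * u = s * (t * s * t)"
    and u_sjt: "u * (t * j * s * j * t) * u = (t * j * s * j * t) * (t * j * t * s * t * j * t)"
    and vv: "v * v = 1" and vs: "v * s * v = s" and vu: "v * u * v = u * v * u"
    and vj: "v * j * v = j" and vr: "v * r * v = R"
    and v_st: "v * (t * s * t) * v = R * t * s * t * r"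
    and v_sjt: "v * (t * j * s * j * t) * v = R * t * j * s * j * t * r"
    and w_w: "w' * w' = 1" and wr: "w' * r * w' = R" and ws: "w' * s * w' = s"
    and wj: "w' * j * w' = j" and wu: "w' * u * w' = u"
    and w_st: "w' * (t * s * t) * w' = t * s * t"
    and w_sjt: "w' * (t * j * s * j * t) * w' = t * j * s * j * t"
    and wv: "w' * v * w' = v * w' * v"
begin

lemma f_word: "t * j * s * j * t = f"
  by (simp only: f_eq ct_def cj_def mult.assoc)
lemma d_word: "t * j * t * s * t * j * t = d"
  by (simp only: d_def cn_def ct_def cj_def mult.assoc)
lemma a_word: "t * s * t = a" by (simp only: ct_def)
lemmas words = f_word d_word a_word

lemma n_af: "n = a * f * a"
proof -
  have "f = a * n * a" by (simp only: f_def cn_def' nan)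
  then have "a * f * a = (a * a) * n * (a * a)" by (simp only: mult.assoc)
  then show ?thesis by (simp add: aa)
qed

text \<open>The defining relations prescribe how a new symbol acts on \<open>r\<close>,
  \<open>s\<close> and the conjugates \<open>a\<close> = s^t and \<open>f\<close> = s^(jt). This
  determines the rest, as \<open>n = a * f * a\<close> and \<open>d = n * s * n\<close>.\<close>

lemma conj_gens:
  assumes x: "x * x = 1" and G: "{r, s, n} \<subseteq> gen X" "a \<in> gen X" "f \<in> gen X"
    and "x * r * x \<in> gen X" "x * s * x \<in> gen X" "x * a * x \<in> gen X" "x * f * x \<in> gen X"
    and y: "y \<in> gens_P"
  shows "x * y * x \<in> gen X"
proof -
  have m: "x * (g * h) * x = (x * g * x) * (x * h * x)" for g h
    by (simp add: mult.assoc x[THEN mult_eqI2])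
  have n: "x * n * x \<in> gen X" using assms unfolding n_af by (simp only: m gen_closed)
  have d: "x * d * x \<in> gen X" using assms n unfolding d_def cn_def' by (simp only: m gen_closed)
  show ?thesis using n d assms y by auto
qed

abbreviation "gens_L \<equiv> insert j gens_P"
abbreviation "gens_22 \<equiv> insert u gens_L"
abbreviation "gens_23 \<equiv> insert v gens_22"
abbreviation "gens_24 \<equiv> insert w' gens_23"

lemma a_gen: "a \<in> gen gens_P"
  unfolding a_eq by (intro gen_closed gen_incl) auto

lemma R_gen: "R \<in> gen gens_P"
  unfolding rr[symmetric] by (intro gen_closed gen_incl) auto

lemma gens_L_mono: "g \<in> gen gens_P \<Longrightarrow> g \<in> gen gens_L"
  "g \<in> gen gens_L \<Longrightarrow> g \<in> gen gens_22"
  using gen_mono[of gens_P gens_L] gen_mono[of gens_L gens_22] by blast+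

text \<open>As a permutation, \<open>u\<close> interchanges \<open>new_u\<close> and [1,0,0], so it
  normalizes the stabilizer of [1,0,0] in PSL_3(4). In the same way \<open>v\<close> interchanges
  two points fixed by PSL_3(4), and \<open>w'\<close> the two points fixed by M_22.\<close>

lemma M22_dcoset: "gen gens_22 \<subseteq> dcoset (gen gens_L) {u}"
proof (rule gen_insert_dcoset[OF uu L_dcoset])
  fix q assume q: "q \<in> gen gens_P"
  have "u * q * u \<in> gen gens_P"
  proof (rule gen_conj[OF uu _ q])
    fix y assume "y \<in> gens_P"
    then show "u * y * u \<in> gen gens_P"
      by (rule conj_gens[OF uu, rotated -1])
         (simp_all add: a_gen R_gen gen_incl ur us u_st[unfolded words] u_sjt[unfolded words] gen_closed)
  qed
  then show "q \<in> gen gens_L \<and> u * q * u \<in> gen gens_L" using q gens_L_mono by blast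
next
  show "y \<in> {j} \<Longrightarrow> u * y * u \<in> dcoset (gen gens_L) {u}" for y
    using braid_dcoset[OF uj] by (simp add: gen_incl)
qed

lemma M23_dcoset: "gen gens_23 \<subseteq> dcoset (gen gens_22) {v}"
proof (rule gen_insert_dcoset[OF vv M22_dcoset])
  fix q assume q: "q \<in> gen gens_L"
  have v_a: "v * a * v = R * a * r"
    using v_st by (simp only: a_word[symmetric] mult.assoc)
  have v_f: "v * f * v = R * f * r"
    using v_sjt by (simp only: f_word[symmetric] mult.assoc)
  have "v * q * v \<in> gen gens_L"
  proof (rule gen_conj[OF vv _ q])
    fix y assume "y \<in> gens_L"
    moreover have "v * y * v \<in> gen gens_L" if "y \<in> gens_P"
      using that
      by (rule conj_gens[OF vv, rotated -1])
         (simp_all add: a_gen[THEN gens_L_mono(1)] R_gen[THEN gens_L_mono(1)] gen_incl gen_closed vr vs v_a v_f)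
    ultimately show "v * y * v \<in> gen gens_L" by (auto simp: vj gen_incl)
  qed
  then show "q \<in> gen gens_22 \<and> v * q * v \<in> gen gens_22" using q gens_L_mono by blast
next
  show "y \<in> {u} \<Longrightarrow> v * y * v \<in> dcoset (gen gens_22) {v}" for y
    using braid_dcoset[OF vu] by (simp add: gen_incl)
qed

lemma M24_dcoset: "gen gens_24 \<subseteq> dcoset (gen gens_23) {w'}"
proof (rule gen_insert_dcoset[OF w_w M23_dcoset])
  fix q assume q: "q \<in> gen gens_22"
  have "w' * q * w' \<in> gen gens_22"
  proof (rule gen_conj[OF w_w _ q])
    fix y assume "y \<in> gens_22"
    moreover have "w' * y * w' \<in> gen gens_22" if "y \<in> gens_P"
      using that
      by (rule conj_gens[OF w_w, rotated -1])
         (simp_all add: a_gen[THEN gens_L_mono(1), THEN gens_L_mono(2)] R_gen[THEN gens_L_mono(1), THEN gens_L_mono(2)] gen_incl wr ws w_st[unfolded words] w_sjt[unfolded words])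
    ultimately show "w' * y * w' \<in> gen gens_22" by (auto simp: wj wu gen_incl)
  qed
  then show "q \<in> gen gens_23 \<and> w' * q * w' \<in> gen gens_23" using q gen_mono[of gens_22 gens_23] by blast
next
  show "y \<in> {v} \<Longrightarrow> w' * y * w' \<in> dcoset (gen gens_23) {w'}" for y
    using braid_dcoset[OF wv] by (simp add: gen_incl)
qed

end

section \<open>The permutations of the 24 points\<close>

definition pp :: "'a::field \<Rightarrow> 'a \<Rightarrow> 'a \<Rightarrow> 'a ext_point" where
  "pp x y z = Pt (proj_point (vector [x, y, z]))"

lemma vec3_eq_iff: "(v :: 'a::zero ^ 3) = w \<longleftrightarrow> v$1 = w$1 \<and> v$2 = w$2 \<and> v$3 = w$3"
  by (simp add: vec_eq_iff forall_3)

lemma vector3_nonzero: "vector [x, y, z] \<noteq> (0 :: 'a::zero ^ 3) \<longleftrightarrow> x \<noteq> 0 \<or> y \<noteq> 0 \<or> z \<noteq> 0"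
  by (simp add: vec3_eq_iff)

lemma smult_vector3: "c *s vector [x, y, z] = (vector [c * x, c * y, c * z] :: 'a::field ^ 3)"
  by (simp add: vec3_eq_iff)

lemma proj_point_eq_iff: "proj_point v = proj_point w \<longleftrightarrow> (\<exists>c. c \<noteq> 0 \<and> v = c *s w)"
proof
  assume "proj_point v = proj_point w"
  moreover have "v \<in> proj_point v" unfolding proj_point_def by (auto intro: exI[of _ 1])
  ultimately have "v \<in> proj_point w" by simp
  then show "\<exists>c. c \<noteq> 0 \<and> v = c *s w" by (auto simp: proj_point_def)
next
  assume "\<exists>c. c \<noteq> 0 \<and> v = c *s w"
  then obtain c where c: "c \<noteq> 0" "v = c *s w" by auto
  show "proj_point v = proj_point w"
  proof (intro equalityI subsetI)
    fix x assume "x \<in> proj_point v"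
    then obtain k where "x = (k * c) *s w" "k * c \<noteq> 0" using c by (auto simp: proj_point_def vector_smult_assoc)
    then show "x \<in> proj_point w" unfolding proj_point_def by blast
  next
    fix x assume "x \<in> proj_point w"
    then obtain k where "x = (k / c) *s v" "k / c \<noteq> 0" using c by (auto simp: proj_point_def vector_smult_assoc)
    then show "x \<in> proj_point v" unfolding proj_point_def by blast
  qed
qed

lemma pp_eq_iff: "pp x y z = pp x' y' z' \<longleftrightarrow> (\<exists>c. c \<noteq> 0 \<and> x = c * x' \<and> y = c * y' \<and> z = c * z')"
  by (simp add: pp_def proj_point_eq_iff smult_vector3 vec3_eq_iff)

lemma ext_plane_pp: "ext_plane = {pp x y z | x y z. x \<noteq> 0 \<or> y \<noteq> 0 \<or> z \<noteq> 0} \<union> {new_u, new_v, new_w}"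
proof -
  have 1: "\<exists>x y z. v = vector [x, y, z]" for v :: "'a ^ 3"
    by (intro exI[of _ "v$1"] exI[of _ "v$2"] exI[of _ "v$3"]) (simp add: vec3_eq_iff)
  have "Pt ` proj_plane = {pp x y z | x y z. x \<noteq> 0 \<or> y \<noteq> 0 \<or> z \<noteq> (0::'a)}"
  proof (intro equalityI subsetI)
    fix p :: "'a ext_point" assume "p \<in> Pt ` proj_plane"
    then obtain v where v: "p = Pt (proj_point v)" "v \<noteq> 0" by (auto simp: proj_plane_def)
    moreover obtain x y z where "v = vector [x, y, z]" using 1 by blast
    ultimately have "p = pp x y z" "x \<noteq> 0 \<or> y \<noteq> 0 \<or> z \<noteq> 0"
      by (auto simp: pp_def vector3_nonzero)
    then show "p \<in> {pp x y z | x y z. x \<noteq> 0 \<or> y \<noteq> 0 \<or> z \<noteq> 0}" by blast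
  next
    fix p :: "'a ext_point" assume "p \<in> {pp x y z | x y z. x \<noteq> 0 \<or> y \<noteq> 0 \<or> z \<noteq> 0}"
    then obtain x y z where "p = pp x y z" "vector [x, y, z] \<noteq> (0 :: 'a ^ 3)"
      unfolding vector3_nonzero by blast
    then show "p \<in> Pt ` proj_plane" unfolding pp_def proj_plane_def by blast
  qed
  then show ?thesis by (simp add: ext_plane_def)
qed

lemma ext_plane_simps [simp]:
  "new_u \<in> ext_plane" "new_v \<in> ext_plane" "new_w \<in> ext_plane"
  "pp x y z \<noteq> new_u" "pp x y z \<noteq> new_v" "pp x y z \<noteq> new_w"
  "new_u \<noteq> pp x y z" "new_v \<noteq> pp x y z" "new_w \<noteq> pp x y z"
  by (auto simp: ext_plane_def pp_def)

lemma pp_in_ext_plane: "x \<noteq> 0 \<or> y \<noteq> 0 \<or> z \<noteq> 0 \<Longrightarrow> pp x y z \<in> ext_plane"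
  by (auto simp: ext_plane_pp)

lemma matrix_perm_pp:
  assumes "x \<noteq> 0 \<or> y \<noteq> 0 \<or> z \<noteq> 0"
  shows "matrix_perm (vector [vector [a, b, c], vector [d, e, f], vector [g, h, i]]) (pp x y z) =
    pp (a * x + b * y + c * z) (d * x + e * y + f * z) (g * x + h * y + i * z)"
proof -
  let ?A = "vector [vector [a, b, c], vector [d, e, f], vector [g, h, i]] :: 'a ^ 3 ^ 3"
  have "proj_map ((*v) ?A) (proj_point (vector [x, y, z])) = proj_point (?A *v vector [x, y, z])"
    by (rule proj_map_proj_point) (auto intro!: exI simp: vector_scalar_commute)
  moreover have "?A *v vector [x, y, z] =
    vector [a * x + b * y + c * z, d * x + e * y + f * z, g * x + h * y + i * z]"
    by (simp add: vec3_eq_iff matrix_vector_mult_def sum_3)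
  ultimately show ?thesis
    using pp_in_ext_plane[OF assms] by (simp add: matrix_perm_def pp_def)
qed

lemma matrix_perm_new [simp]:
  "matrix_perm A new_u = new_u" "matrix_perm A new_v = new_v" "matrix_perm A new_w = new_w"
  by (simp_all add: matrix_perm_def)

lemma m24_perm_pp:
  assumes "x \<noteq> 0 \<or> y \<noteq> 0 \<or> z \<noteq> 0"
  shows "m24_perm \<zeta> sym_s (pp x y z) = pp (x + y) y z"
    and "m24_perm \<zeta> sym_j (pp x y z) = pp y x z"
    and "m24_perm \<zeta> sym_t (pp x y z) = pp z y x"
    and "m24_perm \<zeta> sym_r (pp x y z) = pp (\<zeta> * x) y (inverse \<zeta> * z)"
    and "m24_perm \<zeta> sym_u (pp x y z) = (if y = 0 \<and> z = 0 then new_u else pp (x\<^sup>2 + y * z) (y\<^sup>2) (z\<^sup>2))"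
    and "\<zeta> \<noteq> 0 \<Longrightarrow> m24_perm \<zeta> sym_v (pp x y z) = pp (x\<^sup>2) (y\<^sup>2) (\<zeta> * z\<^sup>2)"
    and "m24_perm \<zeta> sym_w (pp x y z) = pp (x\<^sup>2) (y\<^sup>2) (z\<^sup>2)"
proof -
  \<comment> \<open>The coordinate formulas of \<open>u\<close>, \<open>v\<close> and
    \<open>w\<close> are homogeneous of degree two, so scaling a vector by c scales its image by c
    squared.\<close>
  have m: "proj_map f (proj_point v) = proj_point (f v)"
    if "\<And>c. f (c *s v) = c\<^sup>2 *s f v" for f and v :: "'a ^ 3"
    by (rule proj_map_proj_point) (use that in \<open>auto intro: exI[of _ "_\<^sup>2"]\<close>)
  have P: "pp x y z \<in> ext_plane" using assms by (rule pp_in_ext_plane)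
  have u: "proj_point (vector [x, y, z]) = proj_point (vector [1, 0, 0]) \<longleftrightarrow> y = 0 \<and> z = 0"
    using assms pp_eq_iff[of x y z 1 0 0] by (auto simp: pp_def)
  show "m24_perm \<zeta> sym_s (pp x y z) = pp (x + y) y z"
    "m24_perm \<zeta> sym_j (pp x y z) = pp y x z"
    "m24_perm \<zeta> sym_t (pp x y z) = pp z y x"
    "m24_perm \<zeta> sym_r (pp x y z) = pp (\<zeta> * x) y (inverse \<zeta> * z)"
    using matrix_perm_pp[OF assms] by simp_all
  have "proj_map (\<lambda>a. vector [(a$1)\<^sup>2 + a$2 * a$3, (a$2)\<^sup>2, (a$3)\<^sup>2]) (proj_point (vector [x, y, z])) =
    proj_point (vector [x\<^sup>2 + y * z, y\<^sup>2, z\<^sup>2])"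
    by (subst m) (simp_all add: vec3_eq_iff power2_eq_square algebra_simps)
  then show "m24_perm \<zeta> sym_u (pp x y z) = (if y = 0 \<and> z = 0 then new_u else pp (x\<^sup>2 + y * z) (y\<^sup>2) (z\<^sup>2))"
    using P u by (simp add: pp_def)
  have "proj_map (\<lambda>a. vector [(a$1)\<^sup>2, (a$2)\<^sup>2, \<zeta> * (a$3)\<^sup>2]) (proj_point (vector [x, y, z])) =
    proj_point (vector [x\<^sup>2, y\<^sup>2, \<zeta> * z\<^sup>2])"
    by (subst m) (simp_all add: vec3_eq_iff power2_eq_square algebra_simps)
  then show "\<zeta> \<noteq> 0 \<Longrightarrow> m24_perm \<zeta> sym_v (pp x y z) = pp (x\<^sup>2) (y\<^sup>2) (\<zeta> * z\<^sup>2)"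
    using P by (simp add: pp_def)
  have "proj_map (\<lambda>a. vector [(a$1)\<^sup>2, (a$2)\<^sup>2, (a$3)\<^sup>2]) (proj_point (vector [x, y, z])) =
    proj_point (vector [x\<^sup>2, y\<^sup>2, z\<^sup>2])"
    by (subst m) (simp_all add: vec3_eq_iff power2_eq_square algebra_simps)
  then show "m24_perm \<zeta> sym_w (pp x y z) = pp (x\<^sup>2) (y\<^sup>2) (z\<^sup>2)"
    using P by (simp add: pp_def)
qed

lemma m24_perm_new:
  "m24_perm \<zeta> sym_s new_u = new_u" "m24_perm \<zeta> sym_s new_v = new_v" "m24_perm \<zeta> sym_s new_w = new_w"
  "m24_perm \<zeta> sym_j new_u = new_u" "m24_perm \<zeta> sym_j new_v = new_v" "m24_perm \<zeta> sym_j new_w = new_w"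
  "m24_perm \<zeta> sym_t new_u = new_u" "m24_perm \<zeta> sym_t new_v = new_v" "m24_perm \<zeta> sym_t new_w = new_w"
  "m24_perm \<zeta> sym_r new_u = new_u" "m24_perm \<zeta> sym_r new_v = new_v" "m24_perm \<zeta> sym_r new_w = new_w"
  "m24_perm \<zeta> sym_u new_u = pp 1 0 0" "m24_perm \<zeta> sym_u new_v = new_v" "m24_perm \<zeta> sym_u new_w = new_w"
  "m24_perm \<zeta> sym_v new_u = new_v" "m24_perm \<zeta> sym_v new_v = new_u" "m24_perm \<zeta> sym_v new_w = new_w"
  "m24_perm \<zeta> sym_w new_u = new_u" "m24_perm \<zeta> sym_w new_v = new_w" "m24_perm \<zeta> sym_w new_w = new_v"
  by (simp_all add: pp_def)

section \<open>Arithmetic of GF(4) and the list of the 24 points\<close>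

locale gf4 =
  fixes \<zeta> :: "'a::field"
  assumes card_gf4: "CARD('a) = 4" and primitive: "primitive_element \<zeta>"
begin

lemma fin: "finite (UNIV :: 'a set)"
  using card_gf4 by (metis card.infinite zero_neq_numeral)

lemma zeta_nonzero: "\<zeta> \<noteq> 0"
  using primitive by (simp add: primitive_element_def)

text \<open>Translation by 1 permutes the field, so adding 1 to each of the four elements does not
  change their sum.\<close>

lemma two_eq_zero: "(2::'a) = 0"
proof -
  have "(\<Sum>x\<in>UNIV. x + 1) = (\<Sum>x\<in>UNIV. (x::'a))"
    by (rule sum.reindex_bij_witness[of _ "\<lambda>x. x - 1" "\<lambda>x. x + 1"]) auto
  then have "of_nat CARD('a) = (0::'a)" by (simp add: sum.distrib)
  then have "(2::'a) * 2 = 0" by (simp add: card_gf4)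
  then show ?thesis by (metis mult_eq_0_iff)
qed

lemma add_self: "x + x = (0::'a)"
  by (metis mult_2 mult_zero_left two_eq_zero)

text \<open>Multiplication by \<open>\<zeta>\<close> permutes the three non-zero elements, so it
  does not change their product.\<close>

lemma zeta_cubed: "\<zeta> ^ 3 = 1"
proof -
  have "(\<Prod>x\<in>UNIV - {0}. \<zeta> * x) = (\<Prod>x\<in>UNIV - {0}. x)"
    by (rule prod.reindex_bij_witness[of _ "\<lambda>x. x / \<zeta>" "\<lambda>x. \<zeta> * x"]) (auto simp: zeta_nonzero)
  then have "\<zeta> ^ card (UNIV - {0::'a}) * (\<Prod>x\<in>UNIV - {0}. x) = (\<Prod>x\<in>UNIV - {0}. x)"
    by (simp add: prod.distrib)
  moreover have "(\<Prod>x\<in>UNIV - {0}. x) \<noteq> (0::'a)" using fin by simp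
  ultimately show ?thesis using fin by (simp add: card_gf4)
qed

definition "\<eta> = \<zeta> * \<zeta>"

lemma UNIV_gf4: "x = 0 \<or> x = 1 \<or> x = \<zeta> \<or> x = \<eta>"
proof (cases "x = 0")
  case False
  then obtain n where n: "x = \<zeta> ^ n" using primitive by (auto simp: primitive_element_def)
  have "x = \<zeta> ^ (3 * (n div 3) + n mod 3)" using n by simp
  also have "\<dots> = \<zeta> ^ (n mod 3)" by (simp only: power_add power_mult zeta_cubed power_one mult_1_left)
  finally have "x = \<zeta> ^ (n mod 3)" .
  moreover have "n mod 3 = 0 \<or> n mod 3 = 1 \<or> n mod 3 = 2" by auto
  ultimately show ?thesis by (auto simp: \<eta>_def power2_eq_square)
qed simp

lemma zeta_neq_one: "\<zeta> \<noteq> 1"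
proof
  assume "\<zeta> = 1"
  then have "x = 0 \<or> x = 1" for x :: 'a using UNIV_gf4[of x] unfolding \<eta>_def by simp
  then have "UNIV = {0, 1::'a}" by auto
  then have "CARD('a) = card {0, 1::'a}" by simp
  then show False by (simp add: card_gf4)
qed

lemma zeta_add_one: "\<zeta> + 1 = \<eta>"
proof -
  have "(\<zeta> - 1) * (\<zeta> * \<zeta> + \<zeta> + 1) = \<zeta> ^ 3 - 1" by (simp add: algebra_simps power3_eq_cube)
  then have "\<zeta> * \<zeta> + \<zeta> + 1 = 0" using zeta_cubed zeta_neq_one by simp
  then show ?thesis unfolding \<eta>_def by (metis add.assoc add_self add_right_cancel)
qed

lemma gf4_add: "1 + 1 = (0::'a)" "\<zeta> + \<zeta> = 0" "\<eta> + \<eta> = 0" "\<zeta> + 1 = \<eta>" "1 + \<zeta> = \<eta>"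
  "\<eta> + 1 = \<zeta>" "1 + \<eta> = \<zeta>" "\<zeta> + \<eta> = 1" "\<eta> + \<zeta> = 1"
  using add_self zeta_add_one by (simp_all add: add_ac) (metis add.assoc add.commute add_0 add_self zeta_add_one)+

lemma gf4_mult: "\<zeta> * \<zeta> = \<eta>" "\<zeta> * \<eta> = 1" "\<eta> * \<zeta> = 1" "\<eta> * \<eta> = \<zeta>"
  using zeta_cubed by (simp_all add: \<eta>_def power3_eq_cube mult_ac)
    
lemma gf4_neq: "\<zeta> \<noteq> 0" "\<zeta> \<noteq> 1" "\<eta> \<noteq> 0" "\<eta> \<noteq> 1" "\<eta> \<noteq> \<zeta>"
  "0 \<noteq> \<zeta>" "1 \<noteq> \<zeta>" "0 \<noteq> \<eta>" "1 \<noteq> \<eta>" "\<zeta> \<noteq> \<eta>"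
  using zeta_nonzero zeta_neq_one gf4_mult zeta_add_one by auto

lemma gf4_inverse: "inverse \<zeta> = \<eta>" "inverse \<eta> = \<zeta>"
  using gf4_mult(2) by (simp_all add: inverse_unique gf4_mult)

lemmas gf4_simps = gf4_add gf4_mult gf4_neq gf4_inverse two_eq_zero power2_eq_square

text \<open>Rewriting to last non-zero coordinate 1 gives each point a unique normal form, so
  evaluations can be compared by simplification.\<close>

lemma pp_normalize:
  "pp x y \<zeta> = pp (\<eta> * x) (\<eta> * y) 1" "pp x y \<eta> = pp (\<zeta> * x) (\<zeta> * y) 1"
  "pp x \<zeta> 0 = pp (\<eta> * x) 1 0" "pp x \<eta> 0 = pp (\<zeta> * x) 1 0"
  "pp \<zeta> 0 0 = pp 1 0 0" "pp \<eta> 0 0 = pp 1 0 0"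
proof -
  have "pp x y z = pp (c * x) (c * y) (c * z)" if "c \<noteq> 0" for x y z c :: 'a
    unfolding pp_eq_iff using that by (intro exI[of _ "inverse c"]) simp
  from this[of \<eta>] this[of \<zeta>] show
  "pp x y \<zeta> = pp (\<eta> * x) (\<eta> * y) 1" "pp x y \<eta> = pp (\<zeta> * x) (\<zeta> * y) 1"
  "pp x \<zeta> 0 = pp (\<eta> * x) 1 0" "pp x \<eta> 0 = pp (\<zeta> * x) 1 0"
  "pp \<zeta> 0 0 = pp 1 0 0" "pp \<eta> 0 0 = pp 1 0 0"
    by (metis gf4_neq gf4_mult mult_zero_right)+
qed

lemma ext_plane_list:
  "ext_plane = {new_u, new_v, new_w, pp 1 0 0, pp 0 1 0, pp 1 1 0, pp \<zeta> 1 0, pp \<eta> 1 0,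
    pp 0 0 1, pp 1 0 1, pp \<zeta> 0 1, pp \<eta> 0 1, pp 0 1 1, pp 1 1 1, pp \<zeta> 1 1, pp \<eta> 1 1,
    pp 0 \<zeta> 1, pp 1 \<zeta> 1, pp \<zeta> \<zeta> 1, pp \<eta> \<zeta> 1, pp 0 \<eta> 1, pp 1 \<eta> 1, pp \<zeta> \<eta> 1, pp \<eta> \<eta> 1}"
proof (intro equalityI subsetI)
  fix p :: "'a ext_point" assume "p \<in> ext_plane"
  then consider "p \<in> {new_u, new_v, new_w}" | x y z where "p = pp x y z" "x \<noteq> 0 \<or> y \<noteq> 0 \<or> z \<noteq> 0"
    by (auto simp: ext_plane_pp)
  then show "p \<in> {new_u, new_v, new_w, pp 1 0 0, pp 0 1 0, pp 1 1 0, pp \<zeta> 1 0, pp \<eta> 1 0,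
    pp 0 0 1, pp 1 0 1, pp \<zeta> 0 1, pp \<eta> 0 1, pp 0 1 1, pp 1 1 1, pp \<zeta> 1 1, pp \<eta> 1 1,
    pp 0 \<zeta> 1, pp 1 \<zeta> 1, pp \<zeta> \<zeta> 1, pp \<eta> \<zeta> 1, pp 0 \<eta> 1, pp 1 \<eta> 1, pp \<zeta> \<eta> 1, pp \<eta> \<eta> 1}"
  proof cases
    case 2
    then show ?thesis using UNIV_gf4[of x] UNIV_gf4[of y] UNIV_gf4[of z]
      by (elim disjE) (simp_all add: pp_normalize gf4_simps)
  qed auto
qed (auto intro!: pp_in_ext_plane)

lemmas perm_simps = m24_perm_pp m24_perm_new pp_normalize gf4_simps

end

declare m24_perm.simps [simp del]

section \<open>Generation of the special linear group\<close>

abbreviation mat3 :: "'a::zero \<Rightarrow> 'a \<Rightarrow> 'a \<Rightarrow> 'a \<Rightarrow> 'a \<Rightarrow> 'a \<Rightarrow> 'a \<Rightarrow> 'a \<Rightarrow> 'a \<Rightarrow> 'a ^ 3 ^ 3" where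
  "mat3 a b c d e f g h i \<equiv> vector [vector [a, b, c], vector [d, e, f], vector [g, h, i]]"

text \<open>The zero vector yields a junk value of \<open>pp\<close>; excluding it is how a non-zero
  coordinate of an image point is obtained below.\<close>

lemma pp_000: "pp 0 0 0 \<notin> ext_plane"
proof
  assume "pp 0 0 0 \<in> (ext_plane :: 'a ext_point set)"
  then obtain x y z :: 'a where "pp 0 0 0 = pp x y z" "x \<noteq> 0 \<or> y \<noteq> 0 \<or> z \<noteq> 0"
    by (auto simp: ext_plane_pp)
  then show False unfolding pp_eq_iff by auto
qed

lemma ext_plane_cases:
  assumes "p \<in> ext_plane"
  obtains x y z where "p = pp x y z" "x \<noteq> 0 \<or> y \<noteq> 0 \<or> z \<noteq> 0" | "p \<in> {new_u, new_v, new_w}"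
  using assms by (auto simp: ext_plane_pp)

lemma BijGroup_mult_apply:
  "f \<in> carrier (BijGroup S) \<Longrightarrow> g \<in> carrier (BijGroup S) \<Longrightarrow> p \<in> S \<Longrightarrow> (f \<otimes>\<^bsub>BijGroup S\<^esub> g) p = f (g p)"
  by (simp add: BijGroup_def compose_eq)

lemma carrier_BijGroup_closed: "f \<in> carrier (BijGroup S) \<Longrightarrow> p \<in> S \<Longrightarrow> f p \<in> S"
  by (auto simp: BijGroup_def Bij_def bij_betw_def)

text \<open>\<open>K\<close> stands for the image of the presented group; the aim is to find all of
  \<open>PSL3\<close> in it.\<close>

locale gf4_subgroup = gf4 +
  fixes K :: "('a ext_point \<Rightarrow> 'a ext_point) set"
  assumes K: "subgroup K (BijGroup ext_plane)" and gens: "m24_perm \<zeta> x \<in> K"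
begin

abbreviation "B \<equiv> BijGroup (ext_plane :: 'a ext_point set)"

definition in_K where
  "in_K a b c d e f g h i \<longleftrightarrow> matrix_perm (mat3 a b c d e f g h i) \<in> K"

lemma mult_matrix_perm:
  assumes "in_K a b c d e f g h i"
    and x: "\<And>x y z. x \<noteq> 0 \<or> y \<noteq> 0 \<or> z \<noteq> 0 \<Longrightarrow> m24_perm \<zeta> w (pp x y z) =
      pp (p1 * x + p2 * y + p3 * z) (q1 * x + q2 * y + q3 * z) (r1 * x + r2 * y + r3 * z)"
    and new: "m24_perm \<zeta> w new_u = new_u" "m24_perm \<zeta> w new_v = new_v" "m24_perm \<zeta> w new_w = new_w"
  shows "in_K (p1 * a + p2 * d + p3 * g) (p1 * b + p2 * e + p3 * h) (p1 * c + p2 * f + p3 * i)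
    (q1 * a + q2 * d + q3 * g) (q1 * b + q2 * e + q3 * h) (q1 * c + q2 * f + q3 * i)
    (r1 * a + r2 * d + r3 * g) (r1 * b + r2 * e + r3 * h) (r1 * c + r2 * f + r3 * i)"
    (is "in_K ?a ?b ?c ?d ?e ?f ?g ?h ?i")
proof -
  let ?M = "matrix_perm (mat3 a b c d e f g h i)"
  have M: "?M \<in> K" using assms(1) by (simp add: in_K_def)
  have c: "m24_perm \<zeta> w \<in> carrier B" "?M \<in> carrier B"
    using subgroup.mem_carrier[OF K] gens M by blast+
  have m: "m24_perm \<zeta> w \<otimes>\<^bsub>B\<^esub> ?M \<in> K" by (rule subgroup.m_closed[OF K gens M])
  have "m24_perm \<zeta> w \<otimes>\<^bsub>B\<^esub> ?M = matrix_perm (mat3 ?a ?b ?c ?d ?e ?f ?g ?h ?i)"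
  proof (rule extensionalityI)
    show "m24_perm \<zeta> w \<otimes>\<^bsub>B\<^esub> ?M \<in> extensional ext_plane"
      using subgroup.mem_carrier[OF K m] by (auto simp: BijGroup_def Bij_def)
    show "matrix_perm (mat3 ?a ?b ?c ?d ?e ?f ?g ?h ?i) \<in> extensional ext_plane"
      by (simp add: matrix_perm_def)
    fix p :: "'a ext_point" assume p: "p \<in> ext_plane"
    then show "(m24_perm \<zeta> w \<otimes>\<^bsub>B\<^esub> ?M) p = matrix_perm (mat3 ?a ?b ?c ?d ?e ?f ?g ?h ?i) p"
    proof (cases rule: ext_plane_cases)
      case (1 x y z)
      have Mp: "?M p = pp (a * x + b * y + c * z) (d * x + e * y + f * z) (g * x + h * y + i * z)"
        using 1 by (simp add: matrix_perm_pp)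
      \<comment> \<open>No determinant is at hand, so the image coordinates are seen not to vanish
        simultaneously from \<open>?M\<close> being a bijection of the 24 points.\<close>
      have "?M p \<in> ext_plane" using c(2) p by (rule carrier_BijGroup_closed)
      then have nz: "a * x + b * y + c * z \<noteq> 0 \<or> d * x + e * y + f * z \<noteq> 0 \<or> g * x + h * y + i * z \<noteq> 0"
        using pp_000 unfolding Mp by metis
      have "(m24_perm \<zeta> w \<otimes>\<^bsub>B\<^esub> ?M) p = m24_perm \<zeta> w (?M p)"
        by (rule BijGroup_mult_apply[OF c p])
      also have "\<dots> = matrix_perm (mat3 ?a ?b ?c ?d ?e ?f ?g ?h ?i) p"
        unfolding Mp x[OF nz] 1(1) matrix_perm_pp[OF 1(2)] by (simp add: algebra_simps)
      finally show ?thesis .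
    next
      case 2
      then show ?thesis using new BijGroup_mult_apply[OF c p] by auto
    qed
  qed
  then show ?thesis using m by (simp add: in_K_def)
qed

lemma neg_eq: "- x = (x :: 'a)" using add_self by (metis add_eq_0_iff)

lemma row_s: "in_K a b c d e f g h i \<Longrightarrow> in_K (a + d) (b + e) (c + f) d e f g h i"
  using mult_matrix_perm[of a b c d e f g h i sym_s 1 1 0 0 1 0 0 0 1]
  by (simp add: m24_perm_pp m24_perm_new)
lemma row_j: "in_K a b c d e f g h i \<Longrightarrow> in_K d e f a b c g h i"
  using mult_matrix_perm[of a b c d e f g h i sym_j 0 1 0 1 0 0 0 0 1]
  by (simp add: m24_perm_pp m24_perm_new)
lemma row_t: "in_K a b c d e f g h i \<Longrightarrow> in_K g h i d e f a b c"
  using mult_matrix_perm[of a b c d e f g h i sym_t 0 0 1 0 1 0 1 0 0]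
  by (simp add: m24_perm_pp m24_perm_new)
lemma row_r: "in_K a b c d e f g h i \<Longrightarrow> in_K (\<zeta> * a) (\<zeta> * b) (\<zeta> * c) d e f (\<eta> * g) (\<eta> * h) (\<eta> * i)"
  using mult_matrix_perm[of a b c d e f g h i sym_r \<zeta> 0 0 0 1 0 0 0 \<eta>]
  by (simp add: m24_perm_pp m24_perm_new gf4_inverse)

lemma gf4_mult': "\<zeta> * (\<zeta> * x) = \<eta> * x" "\<zeta> * (\<eta> * x) = x" "\<eta> * (\<zeta> * x) = x" "\<eta> * (\<eta> * x) = \<zeta> * x"
  by (simp_all only: mult.assoc[symmetric] gf4_mult mult_1_left)

text \<open>The coefficients \<open>\<zeta>\<close> and \<open>\<eta>\<close> come from r s r^2 and
  r^2 s r, which scale the first row around the addition. The third row is multiplied by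
  \<open>\<eta>\<close> three times, that is by 1.\<close>

lemma row_add: "in_K a b c d e f g h i \<Longrightarrow> in_K (a + x * d) (b + x * e) (c + x * f) d e f g h i"
  using row_s[of a b c d e f g h i] UNIV_gf4[of x]
    row_r[OF row_s[OF row_r[OF row_r, of a b c d e f g h i]]]
    row_r[OF row_r[OF row_s[OF row_r, of a b c d e f g h i]]]
  by (elim disjE) (simp_all add: gf4_mult gf4_mult' distrib_left)

lemma swap12: "in_K a b c d e f g h i \<longleftrightarrow> in_K d e f a b c g h i"
  using row_j by blast
lemma swap13: "in_K a b c d e f g h i \<longleftrightarrow> in_K g h i d e f a b c"
  using row_t by blast
lemma swap23: "in_K a b c d e f g h i \<longleftrightarrow> in_K a b c g h i d e f"
  using row_t row_j by blast

lemma scale: 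
  assumes "in_K a b c d e f g h i" "k \<noteq> 0"
  shows "in_K (k * a) (k * b) (k * c) (k * d) (k * e) (k * f) (k * g) (k * h) (k * i)"
proof -
  have "matrix_perm (mat3 (k * a) (k * b) (k * c) (k * d) (k * e) (k * f) (k * g) (k * h) (k * i)) =
    matrix_perm (mat3 a b c d e f g h i)"
  proof (rule extensionalityI)
    fix p :: "'a ext_point" assume "p \<in> ext_plane"
    then show "matrix_perm (mat3 (k * a) (k * b) (k * c) (k * d) (k * e) (k * f) (k * g) (k * h) (k * i)) p =
      matrix_perm (mat3 a b c d e f g h i) p"
    proof (cases rule: ext_plane_cases)
      case (1 x y z)
      show ?thesis unfolding 1(1) matrix_perm_pp[OF 1(2)] pp_eq_iff
        using assms(2) by (intro exI[of _ k]) (simp add: algebra_simps)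
    qed auto
  qed (simp_all add: matrix_perm_def)
  then show ?thesis using assms(1) by (simp add: in_K_def)
qed

lemma identity: "in_K 1 0 0 0 1 0 0 0 1"
proof -
  have "in_K 1 1 0 0 1 0 0 0 1" using gens[of sym_s] by (simp add: in_K_def m24_perm.simps)
  from row_s[OF this] show ?thesis by (simp add: gf4_add two_eq_zero)
qed

text \<open>Scalar matrices act trivially and cubes of non-zero elements are 1, so one may divide by
  e. What remains is diag(c, 1, 1/c), a power of \<open>r\<close>.\<close>

lemma diagonal:
  assumes "a * e * i = 1" shows "in_K a 0 0 0 e 0 0 0 i"
proof -
  have e: "e \<noteq> 0" using assms by auto
  have "in_K (a / e) 0 0 0 1 0 0 0 (i / e)"
    using UNIV_gf4[of "a / e"]
  proof (elim disjE)
    have "a / e * (i / e) = 1 / (e * e * e)" using assms e by (simp add: field_simps)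
    also have "e * e * e = 1" using UNIV_gf4[of e] e gf4_mult by auto
    finally have 1: "a / e * (i / e) = 1" by simp
    show "in_K (a / e) 0 0 0 1 0 0 0 (i / e)" if "a / e = 0" using 1 that by simp
    show "in_K (a / e) 0 0 0 1 0 0 0 (i / e)" if "a / e = 1" using 1 that identity by simp
    have "i / e = \<eta>" if "a / e = \<zeta>" using 1 that gf4_inverse by (metis inverse_unique)
    then show "in_K (a / e) 0 0 0 1 0 0 0 (i / e)" if "a / e = \<zeta>"
      using row_r[OF identity] that by simp
    have "i / e = \<zeta>" if "a / e = \<eta>" using 1 that gf4_inverse by (metis inverse_unique)
    then show "in_K (a / e) 0 0 0 1 0 0 0 (i / e)" if "a / e = \<eta>"
      using row_r[OF row_r[OF identity]] that by (simp add: gf4_mult)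
  qed
  from scale[OF this e] show ?thesis using e by simp
qed

lemma upper_triangular:
  assumes "a * e * i = 1" shows "in_K a b c 0 e f 0 0 i"
proof -
  have nz: "e \<noteq> 0" "i \<noteq> 0" using assms by auto
  have 1: "in_K a 0 c 0 e 0 0 0 i" 
    using row_add[OF diagonal[OF assms, unfolded swap23[of a 0 0 0 e]], of "c / i"] nz
    by (simp add: swap23[of a 0 c 0 e])
  have 2: "in_K a b c 0 e 0 0 0 i"
    using row_add[OF 1, of "b / e"] nz by simp
  have "in_K 0 e f 0 0 i a b c"
    using row_add[of 0 e 0 0 0 i a b c "f / i"] 2 nz swap12 swap13 by (metis add_0 mult_zero_right add_0_right nonzero_eq_divide_eq)
  then show ?thesis using swap12 swap13 by metis
qed

lemma block_triangular:
  assumes "a * (e * i - f * h) = 1" shows "in_K a b c 0 e f 0 h i"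
proof (cases "e = 0")
  case True
  have "in_K a b c 0 h i 0 0 f"
    using True assms by (intro upper_triangular) (simp add: neg_eq mult_ac)
  then show ?thesis using True swap23 by simp
next
  case False
  have "a * e * (i - h / e * f) = a * (e * i - f * h)" using False by (simp add: field_simps)
  then have "in_K a b c 0 e f 0 0 (i - h / e * f)"
    using assms by (intro upper_triangular) simp
  then have "in_K 0 0 (i - h / e * f) 0 e f a b c" using swap13 by simp
  from row_add[OF this, of "h / e"] show ?thesis using False swap13 by simp
qed

text \<open>Elimination in the first column. Row exchanges change the determinant by a sign, which
  is invisible in characteristic two.\<close>

lemma in_K_det:
  assumes "a * (e * i - f * h) - b * (d * i - f * g) + c * (d * h - e * g) = 1"
  shows "in_K a b c d e f g h i"
proof -
  have 1: "in_K a b c d e f g h i"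
    if "a \<noteq> 0" "a * (e * i - f * h) - b * (d * i - f * g) + c * (d * h - e * g) = 1" for a b c d e f g h i
  proof -
    \<comment> \<open>The argument runs upwards: the matrix with cleared first column is in
      \<open>K\<close>, and \<open>row_add\<close> puts back these multiples of the first
      row.\<close>
    let ?x = "d / a" and ?y = "g / a"
    have "a * ((e - ?x * b) * (i - ?y * c) - (f - ?x * c) * (h - ?y * b)) =
       a * (e * i - f * h) - b * (d * i - f * g) + c * (d * h - e * g)"
      using that(1) by (simp add: field_simps)
    then have "in_K a b c 0 (e - ?x * b) (f - ?x * c) 0 (h - ?y * b) (i - ?y * c)"
      using that(2) by (intro block_triangular) simp
    then have "in_K 0 (e - ?x * b) (f - ?x * c) a b c 0 (h - ?y * b) (i - ?y * c)"
      by (subst swap12)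
    from row_add[OF this, of ?x] have "in_K d e f a b c 0 (h - ?y * b) (i - ?y * c)"
      using that(1) by simp
    then have "in_K 0 (h - ?y * b) (i - ?y * c) a b c d e f" by (subst swap13)
    from row_add[OF this, of ?y] have "in_K g h i a b c d e f" using that(1) by simp
    then show ?thesis using swap12 swap13 swap23 by metis
  qed
  note nonzero_case = this
  have sub: "x - y = x + y" for x y :: 'a by (metis neg_eq diff_minus_eq_add)
  consider "a \<noteq> 0" | "a = 0" "d \<noteq> 0" | "a = 0" "d = 0" "g \<noteq> 0" using assms by fastforce
  then show ?thesis
  proof cases
    case 1
    then show ?thesis using assms by (rule nonzero_case)
  next
    case 2
    have "in_K d e f a b c g h i"
      using assms 2 by (intro nonzero_case) (simp_all add: sub algebra_simps)
    then show ?thesis by (subst swap12)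
  next
    case 3
    have "in_K g h i d e f a b c"
      using assms 3 by (intro nonzero_case) (simp_all add: sub algebra_simps)
    then show ?thesis by (subst swap13)
  qed
qed

lemma PSL3_subset: "PSL3 \<subseteq> K"
proof
  fix g :: "'a ext_point \<Rightarrow> 'a ext_point" assume "g \<in> PSL3"
  then obtain A :: "'a ^ 3 ^ 3" where A: "g = matrix_perm A" "det A = 1" by (auto simp: PSL3_def)
  have "A = mat3 (A$1$1) (A$1$2) (A$1$3) (A$2$1) (A$2$2) (A$2$3) (A$3$1) (A$3$2) (A$3$3)"
    by (simp add: vec3_eq_iff)
  moreover have "in_K (A$1$1) (A$1$2) (A$1$3) (A$2$1) (A$2$2) (A$2$3) (A$3$1) (A$3$2) (A$3$3)"
    using A(2) by (intro in_K_det) (simp add: det_3 algebra_simps)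
  ultimately show "g \<in> K" using A(1) by (simp add: in_K_def)
qed

end

section \<open>Evaluation of words on the 24 points\<close>

context gf4 begin

lemma m24_perm_closed: "p \<in> ext_plane \<Longrightarrow> m24_perm \<zeta> x p \<in> ext_plane"
proof -
  have "\<forall>p\<in>ext_plane. m24_perm \<zeta> x p \<in> ext_plane"
    by (subst ext_plane_list, cases x) (simp_all add: perm_simps pp_in_ext_plane)
  then show "p \<in> ext_plane \<Longrightarrow> m24_perm \<zeta> x p \<in> ext_plane" by blast
qed

lemma m24_perm_invol: "x \<noteq> sym_r \<Longrightarrow> p \<in> ext_plane \<Longrightarrow> m24_perm \<zeta> x (m24_perm \<zeta> x p) = p"
proof -
  assume x: "x \<noteq> sym_r"
  have "\<forall>p\<in>ext_plane. m24_perm \<zeta> x (m24_perm \<zeta> x p) = p"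
    using x by (subst ext_plane_list, cases x) (simp_all add: perm_simps)
  then show "p \<in> ext_plane \<Longrightarrow> m24_perm \<zeta> x (m24_perm \<zeta> x p) = p" by blast
qed

lemma m24_perm_r_cubed: "p \<in> ext_plane \<Longrightarrow> m24_perm \<zeta> sym_r (m24_perm \<zeta> sym_r (m24_perm \<zeta> sym_r p)) = p"
proof -
  have "\<forall>p\<in>ext_plane. m24_perm \<zeta> sym_r (m24_perm \<zeta> sym_r (m24_perm \<zeta> sym_r p)) = p"
    by (subst ext_plane_list) (simp add: perm_simps)
  then show "p \<in> ext_plane \<Longrightarrow> m24_perm \<zeta> sym_r (m24_perm \<zeta> sym_r (m24_perm \<zeta> sym_r p)) = p" by blast
qed

text \<open>Inverse letters act by the first or second power of the permutation, so words can be
  evaluated on a point by rewriting alone.\<close>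

fun letter_act :: "m24_symbol letter \<Rightarrow> 'a ext_point \<Rightarrow> 'a ext_point" where
  "letter_act (Pos x) p = m24_perm \<zeta> x p"
| "letter_act (Neg x) p = (if x = sym_r then m24_perm \<zeta> x (m24_perm \<zeta> x p) else m24_perm \<zeta> x p)"

lemma m24_perm_inverse:
  assumes "p \<in> ext_plane"
  shows "letter_act (Neg x) (m24_perm \<zeta> x p) = p" "m24_perm \<zeta> x (letter_act (Neg x) p) = p"
    "letter_act l p \<in> ext_plane"
proof -
  show "letter_act (Neg x) (m24_perm \<zeta> x p) = p" "m24_perm \<zeta> x (letter_act (Neg x) p) = p"
    using assms by (simp_all add: m24_perm_invol m24_perm_r_cubed)
  show "letter_act l p \<in> ext_plane"
    using assms by (cases l) (simp_all add: m24_perm_closed)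
qed

lemma m24_perm_Bij: "m24_perm \<zeta> x \<in> Bij ext_plane"
proof -
  have "m24_perm \<zeta> x \<in> extensional ext_plane"
    by (cases x) (simp_all add: matrix_perm_def m24_perm.simps)
  moreover have "bij_betw (m24_perm \<zeta> x) ext_plane ext_plane"
    by (rule bij_betw_byWitness[where f' = "letter_act (Neg x)"])
      (auto simp: m24_perm_inverse m24_perm_closed simp del: letter_act.simps)
  ultimately show ?thesis by (simp add: Bij_def)
qed

abbreviation "B24 \<equiv> BijGroup (ext_plane :: 'a ext_point set)"

lemma m24_perm_carrier: "m24_perm \<zeta> x \<in> carrier B24"
  using m24_perm_Bij by (simp add: BijGroup_def)

lemma letter_val_apply: "p \<in> ext_plane \<Longrightarrow> letter_val B24 (m24_perm \<zeta>) l p = letter_act l p"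
proof (cases l)
  case (Neg x)
  assume p: "p \<in> ext_plane"
  have "bij_betw (m24_perm \<zeta> x) ext_plane ext_plane" using m24_perm_Bij by (simp add: Bij_def)
  then have "inv_into ext_plane (m24_perm \<zeta> x) p = letter_act (Neg x) p"
    by (intro inv_into_f_eq) (auto simp: bij_betw_def m24_perm_inverse p simp del: letter_act.simps)
  then show ?thesis using Neg p
    by (simp add: inv_BijGroup[OF m24_perm_Bij] del: letter_act.simps)
qed (simp)

lemma word_val_carrier: "word_val B24 (m24_perm \<zeta>) w \<in> carrier B24"
proof -
  interpret B: group B24 by (rule group_BijGroup)
  have "letter_val B24 (m24_perm \<zeta>) l \<in> carrier B24" for l
    using m24_perm_carrier by (cases l) (simp_all)
  then show ?thesis by (induction w) (simp_all add: word_val_def)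
qed

lemma word_val_apply:
  "p \<in> ext_plane \<Longrightarrow> word_val B24 (m24_perm \<zeta>) w p = foldr letter_act w p"
proof (induction w arbitrary: p)
  case Nil
  then show ?case by (simp add: word_val_def BijGroup_def)
next
  case (Cons l w)
  interpret B: group B24 by (rule group_BijGroup)
  have l: "letter_val B24 (m24_perm \<zeta>) l \<in> carrier B24"
    using m24_perm_carrier by (cases l) (simp_all)
  note w = carrier_BijGroup_closed[OF word_val_carrier Cons.prems, of w]
  have "word_val B24 (m24_perm \<zeta>) (l # w) p = letter_val B24 (m24_perm \<zeta>) l (word_val B24 (m24_perm \<zeta>) w p)"
    using BijGroup_mult_apply[OF l word_val_carrier Cons.prems] by (simp add: word_val_def)
  also have "\<dots> = letter_act l (word_val B24 (m24_perm \<zeta>) w p)" by (rule letter_val_apply[OF w])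
  finally show ?case by (simp only: Cons foldr_Cons o_apply)
qed

lemma word_val_eqI:
  assumes "\<forall>p\<in>ext_plane. foldr letter_act v p = foldr letter_act w p"
  shows "word_val B24 (m24_perm \<zeta>) v = word_val B24 (m24_perm \<zeta>) w"
proof (rule extensionalityI)
  show "word_val B24 (m24_perm \<zeta>) v \<in> extensional ext_plane" "word_val B24 (m24_perm \<zeta>) w \<in> extensional ext_plane"
    using word_val_carrier by (auto simp: BijGroup_def Bij_def)
  show "word_val B24 (m24_perm \<zeta>) v p = word_val B24 (m24_perm \<zeta>) w p" if "p \<in> ext_plane" for p
    using bspec[OF assms that] by (simp only: word_val_apply[OF that])
qed

lemmas word_defs = wpow_def wconj_def winv_def

abbreviation "same_act v w \<equiv> \<forall>p\<in>ext_plane. foldr letter_act v p = foldr letter_act w p"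

lemma m24_relations_hold:
  assumes "(l, r) \<in> m24_relations"
  shows "word_val B24 (m24_perm \<zeta>) l = word_val B24 (m24_perm \<zeta>) r"
proof (rule word_val_eqI)
  show "same_act l r"
    using assms unfolding m24_relations_def Let_def Un_iff insert_iff empty_iff prod.inject
    by (elim disjE conjE FalseE; hypsubst; unfold ext_plane_list ball_simps;
     simp add: perm_simps word_defs eval_nat_numeral)
qed

end

section \<open>The stabilizer chain and the isomorphism\<close>

locale m24_action = gf4 \<zeta> + m24_rels s j t r R u v w'
  for \<zeta> :: "'a::field" and s j t r R u v w' :: "'g::monoid_mult" +
  fixes act :: "'g \<Rightarrow> 'a ext_point \<Rightarrow> 'a ext_point"
  assumes act_mult: "q \<in> ext_plane \<Longrightarrow> act (g * h) q = act g (act h q)"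
    and act_one: "q \<in> ext_plane \<Longrightarrow> act 1 q = q"
    and act_inj: "inj_on (act g) ext_plane"
    and act_in: "q \<in> ext_plane \<Longrightarrow> act g q \<in> ext_plane"
    and act_gens: "act s = m24_perm \<zeta> sym_s" "act j = m24_perm \<zeta> sym_j" "act t = m24_perm \<zeta> sym_t"
      "act r = m24_perm \<zeta> sym_r" "act u = m24_perm \<zeta> sym_u" "act v = m24_perm \<zeta> sym_v"
      "act w' = m24_perm \<zeta> sym_w"
begin

lemma act_gen:
  assumes "\<And>x. x \<in> X \<Longrightarrow> act x q = q" "q \<in> ext_plane" "g \<in> gen X"
  shows "act g q = q"
  using assms(3) by induction (simp_all add: act_one act_mult assms(1,2))

text \<open>If g = h * y * k fixes q, then h sends both q and the image of q under y to q, and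
  injectivity forces y to fix q.\<close>

lemma dcoset_fix:
  assumes "g \<in> dcoset H Y" "\<And>h. h \<in> H \<Longrightarrow> act h q = q" "\<And>y. y \<in> Y \<Longrightarrow> act y q \<noteq> q"
    and q: "q \<in> ext_plane" and g: "act g q = q"
  shows "g \<in> H"
proof (rule ccontr)
  assume "g \<notin> H"
  then obtain h y k where g': "g = h * y * k" "h \<in> H" "y \<in> Y" "k \<in> H"
    using assms(1) by (auto simp: dcoset_def)
  then have "act h (act y q) = act h q" using g assms(2) q by (simp add: act_mult act_in)
  then have "act y q = q" using act_inj q by (auto dest!: inj_onD intro: act_in)
  then show False using assms(3) g' by blast
qed

lemma act_r_R: "act R q = act r (act r q)" if "q \<in> ext_plane"
  unfolding rr[symmetric] by (rule act_mult[OF that])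

lemma pp_neq: "pp x y 1 = pp x' y' 1 \<longleftrightarrow> x = x' \<and> y = (y' :: 'a)"
  "pp x 1 0 = pp x' 1 0 \<longleftrightarrow> x = x'" "pp 1 0 0 \<noteq> pp x 1 0" "pp x 1 0 \<noteq> pp 1 0 0" 
  "pp x 1 0 \<noteq> pp x' y' 1" "pp x' y' 1 \<noteq> pp x 1 0"
  by (auto simp: pp_eq_iff)

text \<open>The case distinction on vanishing coordinates provides the non-zero coordinate required
  at every intermediate point.\<close>

lemma act_n: "x \<noteq> 0 \<or> y \<noteq> 0 \<or> z \<noteq> 0 \<Longrightarrow> act n (pp x y z) = pp x z y"
  by (cases "x = 0"; cases "y = 0"; cases "z = 0") (simp_all add: ct_def act_mult act_gens m24_perm_pp pp_in_ext_plane act_in)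
lemma act_d: "x \<noteq> 0 \<or> y \<noteq> 0 \<or> z \<noteq> 0 \<Longrightarrow> act d (pp x y z) = pp (x + z) y z"
  by (cases "x = 0"; cases "y = 0"; cases "z = 0") (simp_all add: d_def cn_def' act_mult act_n act_gens m24_perm_pp pp_in_ext_plane act_in)
lemma act_a: "x \<noteq> 0 \<or> y \<noteq> 0 \<or> z \<noteq> 0 \<Longrightarrow> act a (pp x y z) = pp x y (y + z)"
  by (cases "x = 0"; cases "y = 0"; cases "z = 0") (simp_all add: ct_def act_mult act_gens m24_perm_pp pp_in_ext_plane act_in add.commute)
lemma act_f: "x \<noteq> 0 \<or> y \<noteq> 0 \<or> z \<noteq> 0 \<Longrightarrow> act f (pp x y z) = pp x (y + z) z"
  by (cases "x = 0"; cases "y = 0"; cases "z = 0") (simp_all add: f_def cn_def' act_mult act_n act_a pp_in_ext_plane act_in add.commute)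

lemma act_new: "act n new_u = new_u" "act n new_v = new_v" "act n new_w = new_w"
  "act d new_u = new_u" "act d new_v = new_v" "act d new_w = new_w"
  "act f new_u = new_u" "act f new_v = new_v" "act f new_w = new_w"
  by (simp_all add: d_def f_def cn_def' ct_def act_mult act_gens m24_perm_new act_in)

lemmas act_simps = act_n act_d act_f act_new act_gens perm_simps act_mult act_one pp_in_ext_plane act_r_R pp_neq

text \<open>On the points [x,y,1] the groups \<open>V d\<close> and \<open>V f\<close> translate the
  first and the second coordinate, and \<open>C\<close> fixes [0,0,1]; so the image of [0,0,1]
  determines both translations. The factor from \<open>C\<close> is then read off at
  [1,1,0].\<close>

lemma Q_trivial:
  assumes "g \<in> Q" "\<And>q. q \<in> ext_plane \<Longrightarrow> act g q = q"
  shows "g = 1"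
proof -
  obtain x y c where g: "g = x * y * c" "x \<in> V d" "y \<in> V f" "c \<in> C"
    using assms(1) unfolding Q_def by (auto elim!: set_times_elim)
  have "act c (pp 0 0 1) = pp 0 0 1" using g(4) by (auto simp: C_def act_simps)
  moreover have "act g (pp 0 0 1) = act x (act y (act c (pp 0 0 1)))"
    by (simp add: g act_mult act_in pp_in_ext_plane)
  ultimately have "act x (act y (pp 0 0 1)) = pp 0 0 1" using assms(2) by (simp add: pp_in_ext_plane)
  then have "x = 1 \<and> y = 1"
    using g(2,3) unfolding V_def insert_iff empty_iff
    by (elim disjE; hypsubst?; simp add: cr_def act_simps)
  then have "act c (pp 1 1 0) = pp 1 1 0" using assms(2) g by (simp add: pp_in_ext_plane)
  then have "c = 1" using g(4) by (auto simp: C_def act_simps)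
  then show ?thesis using g \<open>x = 1 \<and> y = 1\<close> by simp
qed

lemma descend:
  assumes "g \<in> dcoset (gen X) Y" "\<And>q. q \<in> ext_plane \<Longrightarrow> act g q = q" "q \<in> ext_plane"
    and "\<forall>x\<in>X. act x q = q" "\<forall>y\<in>Y. act y q \<noteq> q"
  shows "g \<in> gen X"
  using assms by (intro dcoset_fix[OF assms(1), of q]) (auto intro: act_gen)

text \<open>Each descent needs a point fixed by the smaller group and moved by the representatives:
  \<open>new_w\<close>, \<open>new_v\<close>, \<open>new_u\<close>, [1,0,0] and [0,1,0] serve in
  turn.\<close>

lemma faithful:
  assumes "g \<in> gen gens_24" and triv: "\<And>q. q \<in> ext_plane \<Longrightarrow> act g q = q"
  shows "g = 1"
proof -
  have "g \<in> dcoset (gen gens_23) {w'}" using assms(1) M24_dcoset by blast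
  from descend[OF this triv, of new_w] have "g \<in> gen gens_23" by (simp add: act_simps)
  then have "g \<in> dcoset (gen gens_22) {v}" using M23_dcoset by blast
  from descend[OF this triv, of new_v] have "g \<in> gen gens_22" by (simp add: act_simps)
  then have "g \<in> dcoset (gen gens_L) {u}" using M22_dcoset by blast
  from descend[OF this triv, of new_u] have "g \<in> gen gens_L" by (simp add: act_simps)
  then have "g \<in> dcoset (gen gens_P) {j}" using L_dcoset by blast
  from descend[OF this triv, of "pp 1 0 0"] have "g \<in> gen gens_P" by (simp add: act_simps)
  then have "g \<in> dcoset Q {s, n}" using P_dcoset by blast
  then have "g \<in> Q"
  proof (rule dcoset_fix)
    have 1: "\<forall>x\<in>{r, d, f}. act x (pp 0 1 0) = pp 0 1 0" by (simp add: act_simps)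
    show "act h (pp 0 1 0) = pp 0 1 0" if "h \<in> Q" for h
      by (rule act_gen[OF bspec[OF 1] _ subsetD[OF Q_gen that]]) (simp_all add: pp_in_ext_plane)
    show "y \<in> {s, n} \<Longrightarrow> act y (pp 0 1 0) \<noteq> pp 0 1 0" for y
      by (auto simp: act_simps)
    show "act g (pp 0 1 0) = pp 0 1 0" "pp 0 1 0 \<in> ext_plane"
      by (simp_all add: triv pp_in_ext_plane)
  qed
  then show ?thesis using triv by (rule Q_trivial)
qed

end

\<comment> \<open>The presented group as a type, and the verification of the abstract relations in
  it\<close>
quotient_type m24_fp = "m24_symbol word" / "pres_eq m24_relations"
  by (intro equivpI reflpI sympI transpI) (auto intro: pres_eq.refl pres_eq.sym pres_eq.trans)

text \<open>The locales above compute in a type of class \<open>monoid_mult\<close>, whereas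
  \<open>presented_group\<close> is a record with a carrier; this quotient type is the
  bridge.\<close>

instantiation m24_fp :: monoid_mult
begin
lift_definition one_m24_fp :: m24_fp is "[]" .
lift_definition times_m24_fp :: "m24_fp \<Rightarrow> m24_fp \<Rightarrow> m24_fp" is "(@)"
  by (rule pres_eq.append)
instance by standard (transfer, simp add: pres_eq.refl)+
end

lemma abs_m24_fp_eq_iff: "abs_m24_fp v = abs_m24_fp w \<longleftrightarrow> pres_eq m24_relations v w"
  by (rule m24_fp.abs_eq_iff)

definition m24_gen :: "m24_symbol \<Rightarrow> m24_fp" where "m24_gen x = abs_m24_fp [Pos x]"

lemma abs_m24_fp_append: "abs_m24_fp (v @ w) = abs_m24_fp v * abs_m24_fp w"
  by (simp add: times_m24_fp.abs_eq)

lemma abs_m24_fp_Nil: "abs_m24_fp [] = 1"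
  by (simp add: one_m24_fp.abs_eq)

lemma abs_m24_fp_Cons: "abs_m24_fp (l # w) = abs_m24_fp [l] * abs_m24_fp w"
  using abs_m24_fp_append[of "[l]" w] by simp

lemma abs_m24_fp_cancel: "m24_gen x * abs_m24_fp [Neg x] = 1" "abs_m24_fp [Neg x] * m24_gen x = 1"
  using pres_eq.cancel[of m24_relations "Pos x"] pres_eq.cancel[of m24_relations "Neg x"]
  by (simp_all add: m24_gen_def flip: abs_m24_fp_append abs_m24_fp_Nil) (simp_all add: abs_m24_fp_eq_iff)

lemma abs_m24_fp_rel: "(v, w) \<in> m24_relations \<Longrightarrow> abs_m24_fp v = abs_m24_fp w"
  by (simp add: abs_m24_fp_eq_iff pres_eq.rel)


lemma rel_square:
  assumes "x * x = 1" "y * y = 1" "(x * y) * (x * y) = 1"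
  shows "x * y * x = (y :: 'g::monoid_mult)"
proof -
  have "x * y * x = (x * y) * (x * y) * y" by (simp add: mult.assoc assms(2))
  then show ?thesis by (simp only: assms(3) mult_1_left)
qed

lemma rel_cube:
  assumes "x * x = 1" "y * y = 1" "(x * y) * (x * y) * (x * y) = 1"
  shows "x * y * x = (y * x * y :: 'g::monoid_mult)"
proof -
  have "x * y * x = ((x * y) * (x * y) * (x * y)) * (y * x * y)"
    by (simp add: mult.assoc assms(1,2) assms(1,2)[THEN mult_eqI2])
  then show ?thesis by (simp only: assms(3) mult_1_left)
qed

lemma rel_invert:
  assumes "x * x = 1" "r * R = 1" "(x * r) * (x * r) = 1"
  shows "x * r * x = (R :: 'g::monoid_mult)"
proof -
  have "x * r * x = (x * r) * (x * r) * R" by (simp add: mult.assoc assms(2))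
  then show ?thesis by (simp only: assms(3) mult_1_left)
qed

lemma abs_m24_fp_wpow: "abs_m24_fp (wpow w 2) = abs_m24_fp w * abs_m24_fp w"
  "abs_m24_fp (wpow w 3) = abs_m24_fp w * abs_m24_fp w * abs_m24_fp w"
  by (simp_all add: wpow_def eval_nat_numeral abs_m24_fp_append mult.assoc)

lemma abs_m24_fp_winv_append: "abs_m24_fp (winv (v @ w)) = abs_m24_fp (winv w) * abs_m24_fp (winv v)"
  by (simp add: winv_def abs_m24_fp_append)

lemma abs_m24_fp_wconj: "abs_m24_fp (wconj v w) = abs_m24_fp (winv w) * abs_m24_fp v * abs_m24_fp w"
  by (simp add: wconj_def abs_m24_fp_append mult.assoc)

lemma winv_singleton: "winv [Pos x] = [Neg x]"
  by (simp add: winv_def)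

lemmas abs_m24_fp_words = abs_m24_fp_wpow abs_m24_fp_wconj abs_m24_fp_winv_append winv_singleton
  abs_m24_fp_append abs_m24_fp_Nil m24_gen_def[symmetric]

lemma abs_m24_fp_relations: "\<forall>x\<in>m24_relations. abs_m24_fp (fst x) = abs_m24_fp (snd x)"
  by (auto intro: abs_m24_fp_rel)

text \<open>The whole presentation as one conjunction of equations between products of generators,
  from which single relations are picked out below.\<close>

lemmas m24_gen_relations = abs_m24_fp_relations[unfolded m24_relations_def Let_def ball_Un ball_simps
  fst_conv snd_conv simp_thms, unfolded abs_m24_fp_words]

lemma rel_cube_order3:
  assumes "x * x = 1" "r * R = 1" "(x * r) * (x * r) * (x * r) = 1"
  shows "x * r * x = (R * x * R :: 'g::monoid_mult)"
proof -
  have "x * r * x = ((x * r) * (x * r) * (x * r)) * (R * x * R)"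
    by (simp add: mult.assoc assms(1,2) assms(1,2)[THEN mult_eqI2])
  then show ?thesis by (simp only: assms(3) mult_1_left)
qed

lemma m24_gen_orders: "m24_gen sym_s * m24_gen sym_s = 1" "m24_gen sym_j * m24_gen sym_j = 1"
  "m24_gen sym_t * m24_gen sym_t = 1" "m24_gen sym_u * m24_gen sym_u = 1"
  "m24_gen sym_v * m24_gen sym_v = 1" "m24_gen sym_w * m24_gen sym_w = 1"
  "m24_gen sym_r * (m24_gen sym_r * m24_gen sym_r) = 1"
  "m24_gen sym_r * m24_gen sym_r * m24_gen sym_r = 1"
proof -
  show 1: "m24_gen sym_s * m24_gen sym_s = 1" "m24_gen sym_j * m24_gen sym_j = 1"
    "m24_gen sym_t * m24_gen sym_t = 1" "m24_gen sym_u * m24_gen sym_u = 1"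
    "m24_gen sym_v * m24_gen sym_v = 1" "m24_gen sym_w * m24_gen sym_w = 1"
    "m24_gen sym_r * m24_gen sym_r * m24_gen sym_r = 1"
    by (insert m24_gen_relations, elim conjE, assumption)+
  then show "m24_gen sym_r * (m24_gen sym_r * m24_gen sym_r) = 1" by (simp only: mult.assoc)
qed

lemma abs_m24_fp_Neg: "m24_gen x * y = 1 \<Longrightarrow> abs_m24_fp [Neg x] = y"
proof -
  assume "m24_gen x * y = 1"
  then have "abs_m24_fp [Neg x] = (abs_m24_fp [Neg x] * m24_gen x) * y"
    by (simp only: mult.assoc mult_1_right)
  then show ?thesis by (simp only: abs_m24_fp_cancel mult_1_left)
qed

lemmas abs_m24_fp_Neg_gens = m24_gen_orders(1-7)[THEN abs_m24_fp_Neg]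

interpretation fp: m24_rels "m24_gen sym_s" "m24_gen sym_j" "m24_gen sym_t" "m24_gen sym_r"
  "m24_gen sym_r * m24_gen sym_r" "m24_gen sym_u" "m24_gen sym_v" "m24_gen sym_w"
proof -
  let ?s = "m24_gen sym_s" and ?j = "m24_gen sym_j" and ?t = "m24_gen sym_t" and ?r = "m24_gen sym_r"
  let ?R = "?r * ?r" and ?u = "m24_gen sym_u" and ?v = "m24_gen sym_v" and ?w = "m24_gen sym_w"
  note 1 = m24_gen_relations and sq = m24_gen_orders(1-6) and r = m24_gen_orders(7,8)
  note 2 = 1[unfolded abs_m24_fp_Neg_gens] and 3 = 1[unfolded abs_m24_fp_Neg_gens mult.assoc]
  have a: "?t * ?s * ?t * (?t * ?s * ?t) = 1"
    by (simp only: mult.assoc sq sq[THEN mult_eqI2] mult_1_left mult_1_right)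
  have f: "?t * ?j * ?s * ?j * ?t * (?t * ?j * ?s * ?j * ?t) = 1"
    by (simp only: mult.assoc sq sq[THEN mult_eqI2] mult_1_left mult_1_right)
  show "m24_rels ?s ?j ?t ?r ?R ?u ?v ?w"
  proof
    show "?s * ?s = 1" "?j * ?j = 1" "?t * ?t = 1" "?u * ?u = 1" "?v * ?v = 1" "?w * ?w = 1"
      "?r * ?R = 1" "?R * ?r = 1" "?r * ?r = ?R" by (rule sq r HOL.refl)+
    show "?j * ?r * ?j = ?R" "?t * ?r * ?t = ?R" "?v * ?r * ?v = ?R" "?w * ?r * ?w = ?R"
      by (rule rel_invert, (rule sq r)+, insert 1, elim conjE, assumption)+
    show "?s * ?r * ?s = ?R * ?s * ?R"
      by (rule rel_cube_order3, (rule sq r)+, insert 1, elim conjE, assumption)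
    show "?j * ?s * ?j = ?s * ?j * ?s" "?t * ?j * ?t = ?j * ?t * ?j" "?u * ?j * ?u = ?j * ?u * ?j"
      "?v * ?u * ?v = ?u * ?v * ?u" "?w * ?v * ?w = ?v * ?w * ?v"
      by (rule rel_cube, (rule sq)+, insert 1, elim conjE, assumption)+
    show "?u * ?s * ?u = ?s" "?v * ?s * ?v = ?s" "?v * ?j * ?v = ?j" "?w * ?s * ?w = ?s"
      "?w * ?j * ?w = ?j" "?w * ?u * ?w = ?u"
      by (rule rel_square, (rule sq)+, insert 1, elim conjE, assumption)+
    show "?w * (?t * ?s * ?t) * ?w = ?t * ?s * ?t"
      by (rule rel_square[OF sq(6) a]) (unfold mult.assoc, insert 3, elim conjE, assumption)
    show "?w * (?t * ?j * ?s * ?j * ?t) * ?w = ?t * ?j * ?s * ?j * ?t"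
      by (rule rel_square[OF sq(6) f]) (unfold mult.assoc, insert 3, elim conjE, assumption)
    show "?t * ?s * ?t * ?j * ?s * (?t * ?s * ?t * ?j * ?s) * (?t * ?s * ?t * ?j * ?s) = 1"
      "?t * ?s * ?t * (?j * ?r) * (?t * ?s * ?t) =
        ?r * ?s * ?R * ?j * ?r * (?t * ?s * ?t) * (?r * ?s * ?R * ?j * ?R * ?s * ?R)"
      unfolding mult.assoc by (insert 3, elim conjE, assumption)+
    show "?u * ?r * ?u = ?R"
    proof -
      \<comment> \<open>The presentation only says r^u = r^j; that \<open>u\<close> inverts
        \<open>r\<close> follows because \<open>j\<close> does.\<close>
      have "?j * ?r * ?j = ?R"
        by (rule rel_invert, (rule sq r)+, insert 1, elim conjE, assumption)
      moreover have "?u * ?r * ?u = ?j * ?r * ?j" using 2 by (elim conjE)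
      ultimately show ?thesis by (rule HOL.trans[rotated])
    qed
    show "?u * (?t * ?s * ?t) * ?u = ?s * (?t * ?s * ?t)"
      "?u * (?t * ?j * ?s * ?j * ?t) * ?u = ?t * ?j * ?s * ?j * ?t * (?t * ?j * ?t * ?s * ?t * ?j * ?t)"
      "?v * (?t * ?s * ?t) * ?v = ?R * ?t * ?s * ?t * ?r"
      "?v * (?t * ?j * ?s * ?j * ?t) * ?v = ?R * ?t * ?j * ?s * ?j * ?t * ?r"
      unfolding mult.assoc by (insert 3, elim conjE, assumption)+
  qed
qed

lemma m24_fp_generated: "g \<in> gen fp.gens_24"
proof -
  \<comment> \<open>\<open>t\<close> is not among the generators of the chain and is recovered from
    \<open>n\<close> and \<open>j\<close>.\<close>
  have n: "m24_gen sym_j * fp.n * m24_gen sym_j = m24_gen sym_t"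
    by (simp only: fp.n_eq mult.assoc fp.orders_assoc mult_1_left mult_1_right)
  have "m24_gen sym_j * fp.n * m24_gen sym_j \<in> gen fp.gens_24"
    by (intro gen_closed gen_incl) auto
  then have P: "m24_gen x \<in> gen fp.gens_24" for x
    by (cases x) (auto simp only: n intro: gen_incl)
  then have N: "abs_m24_fp [Neg x] \<in> gen fp.gens_24" for x
    by (cases x) (simp_all only: abs_m24_fp_Neg_gens gen_closed)
  have "abs_m24_fp w \<in> gen fp.gens_24" for w
  proof (induction w)
    case Nil
    show ?case by (simp only: abs_m24_fp_Nil gen_one)
  next
    case (Cons l w)
    have "abs_m24_fp [l] \<in> gen fp.gens_24" using P N by (cases l) (simp_all only: m24_gen_def)
    then show ?case using Cons by (subst abs_m24_fp_Cons) (rule gen_closed)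
  qed
  then show ?thesis by (metis Quotient3_abs_rep[OF Quotient3_m24_fp])
qed

theorem proposition7p7:
  fixes \<zeta> :: "'a::field"
  assumes "CARD('a) = 4" and "primitive_element \<zeta>"
  shows "\<exists>\<phi> \<in> iso (presented_group m24_relations) (M24 \<zeta>).
    \<forall>x. \<phi> (pres_class m24_relations [Pos x]) = m24_perm \<zeta> x"
proof -
  interpret gf4 \<zeta> using assms by unfold_locales
  let ?P = "presented_group m24_relations" and ?c = "pres_class m24_relations"
  interpret B: group B24 by (rule group_BijGroup)
  interpret P: group ?P by (rule group_presented_group)
  obtain h where h: "h \<in> hom ?P B24" and h_gen: "\<And>x. h (?c [Pos x]) = m24_perm \<zeta> x"
    using presented_group_universal[OF group_BijGroup m24_perm_carrier m24_relations_hold] by blast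
  interpret h: group_hom ?P B24 h by unfold_locales (rule h)
  have c: "?c w \<in> carrier ?P" for w by (simp add: presented_group_def)
  have c_cases: "\<exists>w. x = ?c w" if "x \<in> carrier ?P" for x
    using that by (auto simp: presented_group_def)
  have h_append: "h (?c (v @ w)) = h (?c v) \<otimes>\<^bsub>B24\<^esub> h (?c w)" for v w
    using h.hom_mult[OF c c] by (simp add: pres_class_mult)
  have one: "\<one>\<^bsub>?P\<^esub> = ?c []" by (simp add: presented_group_def)
  define K where "K = h ` carrier ?P"
  have K: "subgroup K B24" unfolding K_def by (rule h.img_is_subgroup)
  have "m24_perm \<zeta> x \<in> K" for x unfolding K_def h_gen[symmetric] by (rule imageI[OF c])
  then interpret K: gf4_subgroup \<zeta> K
    by (intro gf4_subgroup.intro[OF gf4_axioms] gf4_subgroup_axioms.intro[OF K])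
  let ?G = "PSL3 \<union> {m24_perm \<zeta> sym_u, m24_perm \<zeta> sym_v, m24_perm \<zeta> sym_w}"
  have G: "?G \<subseteq> K" using K.PSL3_subset K.gens by auto
  have gens: "m24_perm \<zeta> x \<in> generate B24 ?G" for x
  proof (rule generate.incl)
    \<comment> \<open>The matrices of \<open>j\<close> and \<open>t\<close> have determinant -1 and
      belong to \<open>PSL3\<close> because this equals 1.\<close>
    have neg: "- 1 = (1::'a)" by (rule K.neg_eq)
    show "m24_perm \<zeta> x \<in> ?G"
      using zeta_nonzero
      by (cases x) (auto simp: PSL3_def m24_perm.simps det_3 neg intro!: exI)
  qed
  have h_in: "h (?c w) \<in> generate B24 ?G" for w
  proof (induction w)
    case Nil
    show ?case using generate.one[of B24 ?G] by (simp flip: one)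
  next
    case (Cons l w)
    have "h (?c [l]) \<in> generate B24 ?G"
    proof (cases l)
      case (Pos x)
      then show ?thesis using gens h_gen by simp
    next
      case (Neg x)
      have "?c [Neg x] \<otimes>\<^bsub>?P\<^esub> ?c [Pos x] = \<one>\<^bsub>?P\<^esub>"
        using pres_eq.cancel[of m24_relations "Neg x"] by (simp add: pres_class_mult one pres_class_eq_iff)
      then have "?c [Neg x] = inv\<^bsub>?P\<^esub> ?c [Pos x]" using P.inv_equality[OF _ c c] by simp
      then have "h (?c [Neg x]) = inv\<^bsub>B24\<^esub> m24_perm \<zeta> x" using h.hom_inv[OF c] h_gen by simp
      then show ?thesis using Neg B.generate_m_inv_closed[OF _ gens] G subgroup.subset[OF K] by auto
    qed
    then show ?case using h_append[of "[l]" w] Cons generate.eng by fastforce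
  qed
  have carrier: "carrier (M24 \<zeta>) = K"
  proof -
    have "generate B24 ?G \<subseteq> K" by (rule B.generate_subgroup_incl[OF G K])
    moreover have "K \<subseteq> generate B24 ?G" unfolding K_def using h_in c_cases by blast
    ultimately show ?thesis by (simp add: M24_def)
  qed
  \<comment> \<open>The choice of representative is harmless: equivalent words have the same class,
    hence the same image under \<open>h\<close>.\<close>
  define act where "act g = h (?c (rep_m24_fp g))" for g
  have act_abs: "act (abs_m24_fp w) = h (?c w)" for w
  proof -
    have "?c (rep_m24_fp (abs_m24_fp w)) = ?c w"
      unfolding pres_class_eq_iff abs_m24_fp_eq_iff[symmetric] by (rule Quotient3_abs_rep[OF Quotient3_m24_fp])
    then show ?thesis by (simp add: act_def)
  qed
  have act_carrier: "act g \<in> carrier B24" for g unfolding act_def by (rule h.hom_closed[OF c])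
  have act_mult: "act (g * k) = act g \<otimes>\<^bsub>B24\<^esub> act k" for g k
  proof -
    obtain v w where "g = abs_m24_fp v" "k = abs_m24_fp w"
      by (metis Quotient3_abs_rep[OF Quotient3_m24_fp])
    then show ?thesis by (simp only: act_abs abs_m24_fp_append[symmetric] h_append)
  qed
  interpret act: m24_action \<zeta> "m24_gen sym_s" "m24_gen sym_j" "m24_gen sym_t" "m24_gen sym_r"
    "m24_gen sym_r * m24_gen sym_r" "m24_gen sym_u" "m24_gen sym_v" "m24_gen sym_w" act
  proof
    fix g k q
    show "act (g * k) q = act g (act k q)" if "q \<in> ext_plane"
      unfolding act_mult using act_carrier act_carrier that by (rule BijGroup_mult_apply)
    show "act 1 q = q" if "q \<in> ext_plane"
      using that h.hom_one by (simp add: act_abs one flip: abs_m24_fp_Nil) (simp add: BijGroup_def)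
    show "inj_on (act g) ext_plane"
      using act_carrier by (auto simp: BijGroup_def Bij_def bij_betw_def)
    show "act g q \<in> ext_plane" if "q \<in> ext_plane"
      using act_carrier that by (rule carrier_BijGroup_closed)
  qed (simp_all only: m24_gen_def act_abs h_gen)
  have "inj_on h (carrier ?P)"
  proof (rule h.inj_on_one_iff[THEN iffD2], intro allI impI)
    fix x assume "x \<in> carrier ?P" and x: "h x = \<one>\<^bsub>B24\<^esub>"
    then obtain w where w: "x = ?c w" using c_cases by blast
    have "abs_m24_fp w = 1"
    proof (rule act.faithful[OF m24_fp_generated])
      show "q \<in> ext_plane \<Longrightarrow> act (abs_m24_fp w) q = q" for q
        using x by (simp add: act_abs w) (simp add: BijGroup_def)
    qed
    then show "x = \<one>\<^bsub>?P\<^esub>"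
      by (simp add: w one pres_class_eq_iff abs_m24_fp_eq_iff flip: abs_m24_fp_Nil)
  qed
  moreover have "h \<in> hom ?P (M24 \<zeta>)"
    using h carrier by (auto simp: hom_def K_def M24_def)
  ultimately have "h \<in> iso ?P (M24 \<zeta>)"
    by (simp add: iso_def bij_betw_def carrier K_def)
  then show ?thesis using h_gen by blast
qed

end
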